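(* Let $G$ be a group admitting a finite presentation with set of generators $X$ and relators of the form $[x_1\cdots x_m,y_1\cdots y_n]$, with $x_i,y_j\in X$ and $m,n\ge1$ (depending on the relator). Suppose further that if $[x_1\cdots x_m,y_1\cdots y_n]$ is one of the relators, then so are $[x_i,x_j]$ and $[y_i,y_j]$ for all $i,j$ occurring in the expression. Then $G$ is $1$-formal.
   Context: Let $k$ be a field of characteristic $0$. For a finitely presented group $G=\langle x_1,\dots,x_n\mid r_1,\dots,r_m\rangle$, let $E_n$ be the free complete Lie $k$-algebra on $\bar x_1,\dots,\bar x_n$ (the completion of the free Lie algebra with respect to degree), let $\exp(E_n)$ be the group on the set $E_n$ with the Baker–Campbell–Hausdorff product, and let $\sigma_n:F_n\to\exp(E_n)$ be the homomorphism $x_i\mapsto e^{\bar x_i}$. Let $E_G$ be the quotient of $E_n$ by the closed ideal generated by the elements $\log(\sigma_n(r_j))$, $1\le j\le m$; it is a filtered complete Lie algebra (the Malcev Lie algebra of $G$). $G$ is $1$-formal if $E_G$ is quadratic, i.e. isomorphic as a filtered Lie algebra to a quotient of a free complete Lie algebra by a closed ideal generated by homogeneous elements of degree $2$. *)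

theory Defs
  imports Complex_Main "HOL-Algebra.Coset"
begin

section \<open>Free groups and finite presentations\<close>

text \<open>A letter \<open>(i, True)\<close> stands for \<open>x\<^sub>i\<close> and \<open>(i, False)\<close> for its inverse, with
  generators numbered from \<open>0\<close>. Elements of the free group \<open>F\<^sub>n\<close> are the reduced words in
  the letters with \<open>i < n\<close>.\<close>

type_synonym letter = "nat \<times> bool"

definition cancels :: "letter \<Rightarrow> letter \<Rightarrow> bool" where
  "cancels a b \<longleftrightarrow> fst a = fst b \<and> snd a \<noteq> snd b"

definition reduced :: "letter list \<Rightarrow> bool" where
  "reduced w \<longleftrightarrow> successively (\<lambda>a b. \<not> cancels a b) w"

fun push :: "letter \<Rightarrow> letter list \<Rightarrow> letter list" where
  "push a [] = [a]"
| "push a (b # w) = (if cancels a b then w else a # b # w)"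

definition free_group :: "nat \<Rightarrow> letter list monoid" where
  "free_group n =
     \<lparr>carrier = {w. reduced w \<and> fst ` set w \<subseteq> {..<n}}, mult = foldr push, one = []\<rparr>"

text \<open>The homomorphism out of the free group that sends \<open>x\<^sub>i\<close> to \<open>g i\<close>.\<close>

definition free_lift :: "('g, 'b) monoid_scheme \<Rightarrow> (nat \<Rightarrow> 'g) \<Rightarrow> letter list \<Rightarrow> 'g" where
  "free_lift G g w =
     foldr (\<lambda>(i, s) a. (if s then g i else inv\<^bsub>G\<^esub> g i) \<otimes>\<^bsub>G\<^esub> a) w \<one>\<^bsub>G\<^esub>"

text \<open>Positive words are reduced, so this is the product \<open>x\<^sub>i\<^sub>1 \<cdots> x\<^sub>i\<^sub>m\<close> in the free group.\<close>

definition pos_word :: "nat list \<Rightarrow> letter list" where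
  "pos_word is = map (\<lambda>i. (i, True)) is"

definition commutator :: "('g, 'b) monoid_scheme \<Rightarrow> 'g \<Rightarrow> 'g \<Rightarrow> 'g" where
  "commutator G a b = a \<otimes>\<^bsub>G\<^esub> b \<otimes>\<^bsub>G\<^esub> inv\<^bsub>G\<^esub> a \<otimes>\<^bsub>G\<^esub> inv\<^bsub>G\<^esub> b"

text \<open>\<open>[x\<^sub>i\<^sub>1 \<cdots> x\<^sub>i\<^sub>m, y\<^sub>j\<^sub>1 \<cdots> y\<^sub>j\<^sub>l]\<close> as an element of the free group.\<close>

definition comm_relator :: "nat \<Rightarrow> nat list \<Rightarrow> nat list \<Rightarrow> letter list" where
  "comm_relator n is js = commutator (free_group n) (pos_word is) (pos_word js)"

definition normal_closure :: "('g, 'b) monoid_scheme \<Rightarrow> 'g set \<Rightarrow> 'g set" where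
  "normal_closure G S = \<Inter>{N. N \<lhd> G \<and> S \<subseteq> N}"

text \<open>\<open>\<langle>x\<^sub>0,\<dots>,x\<^sub>n\<^sub>-\<^sub>1 | R\<rangle>\<close> presents \<open>G\<close>, via the epimorphism \<open>\<pi>\<close>.\<close>

definition finite_presentation ::
    "('g, 'b) monoid_scheme \<Rightarrow> nat \<Rightarrow> letter list set \<Rightarrow> (letter list \<Rightarrow> 'g) \<Rightarrow> bool" where
  "finite_presentation G n R \<pi> \<longleftrightarrow>
     finite R \<and> R \<subseteq> carrier (free_group n) \<and> \<pi> \<in> epi (free_group n) G \<and>
     kernel (free_group n) G \<pi> = normal_closure (free_group n) R"

lemma push_reduced: "reduced w \<Longrightarrow> reduced (push a w)"
  by (cases w) (auto simp: reduced_def successively_Cons)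

lemma push_letters: "fst ` set (push a w) \<subseteq> insert (fst a) (fst ` set w)"
  by (cases w) auto

lemma foldr_push_reduced: "reduced v \<Longrightarrow> reduced (foldr push u v)"
  by (induction u) (auto intro: push_reduced)

lemma foldr_push_letters: "fst ` set (foldr push u v) \<subseteq> fst ` set u \<union> fst ` set v"
proof (induction u)
  case (Cons a u)
  then show ?case using push_letters[of a "foldr push u v"] by simp blast
qed simp

lemma push_push:
  assumes "cancels a b" "reduced w"
  shows "push a (push b w) = w"
proof (cases w)
  case (Cons c v)
  show ?thesis
  proof (cases "cancels b c")
    case True
    then have "c = a" using assms(1) by (auto simp: cancels_def prod_eq_iff)
    then have "push a v = a # v"
      using assms(2) Cons by (cases v) (auto simp: reduced_def)
    then show ?thesis using True Cons \<open>c = a\<close> by simp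
  qed (use assms(1) Cons in auto)
qed (use assms(1) in auto)

lemma foldr_push_push:
  assumes "reduced w"
  shows "foldr push (push a v) w = push a (foldr push v w)"
  by (cases v) (use assms in \<open>auto simp: push_push foldr_push_reduced\<close>)

lemma foldr_push_assoc:
  assumes "reduced w"
  shows "foldr push (foldr push u v) w = foldr push u (foldr push v w)"
  by (induction u) (auto simp: foldr_push_push assms)

lemma foldr_push_Nil: "reduced w \<Longrightarrow> foldr push w [] = w"
proof (induction w)
  case (Cons a w)
  then show ?case by (cases w) (auto simp: reduced_def)
qed simp

definition inv_word :: "letter list \<Rightarrow> letter list" where
  "inv_word w = rev (map (\<lambda>(i, s). (i, \<not> s)) w)"

lemma inv_word_reduced: "reduced w \<Longrightarrow> reduced (inv_word w)"
  by (auto simp: inv_word_def reduced_def successively_rev successively_map cancels_def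
      case_prod_beta elim!: successively_mono)

lemma inv_word_mult: "reduced v \<Longrightarrow> foldr push (inv_word w) (foldr push w v) = v"
  by (induction w arbitrary: v)
    (auto simp: inv_word_def push_push cancels_def foldr_push_reduced)

theorem group_free_group: "group (free_group n)"
proof (rule groupI)
  fix w assume w: "w \<in> carrier (free_group n)"
  have "foldr push (inv_word w) (foldr push w []) = []"
    by (rule inv_word_mult) (simp add: reduced_def)
  moreover have "inv_word w \<in> carrier (free_group n)"
    using w inv_word_reduced[of w] by (auto simp: free_group_def inv_word_def)
  ultimately show "\<exists>v\<in>carrier (free_group n). v \<otimes>\<^bsub>free_group n\<^esub> w = \<one>\<^bsub>free_group n\<^esub>"
    using w by (auto simp: free_group_def foldr_push_Nil)
next
  fix u v assume "u \<in> carrier (free_group n)" "v \<in> carrier (free_group n)"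
  then show "u \<otimes>\<^bsub>free_group n\<^esub> v \<in> carrier (free_group n)"
    using foldr_push_letters[of u v] foldr_push_reduced[of v u]
    by (fastforce simp: free_group_def)
qed (auto simp: free_group_def reduced_def foldr_push_assoc[unfolded reduced_def])

theorem (in group) free_lift_hom:
  assumes g: "\<And>i. i < n \<Longrightarrow> g i \<in> carrier G"
  shows "free_lift G g \<in> hom (free_group n) G"
    and "\<And>i. i < n \<Longrightarrow> free_lift G g [(i, True)] = g i"
proof -
  have step: "free_lift G g (a # w) = (if snd a then g (fst a) else inv g (fst a)) \<otimes> free_lift G g w" for a w
    by (auto simp: free_lift_def case_prod_beta)
  have cl: "fst ` set w \<subseteq> {..<n} \<Longrightarrow> free_lift G g w \<in> carrier G" for w
  proof (induction w)
    case Nil then show ?case by (simp add: free_lift_def)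
  next
    case (Cons a w)
    then show ?case using g by (auto simp: step)
  qed
  have push: "free_lift G g (push a w) = free_lift G g (a # w)"
    if "fst ` set (a # w) \<subseteq> {..<n}" for a w
  proof (cases w)
    case (Cons b v)
    have ca: "g (fst b) \<in> carrier G" "free_lift G g v \<in> carrier G"
      using that Cons cl g by auto
    show ?thesis
    proof (cases "cancels a b")
      case True
      then show ?thesis using Cons ca
        by (auto simp: step cancels_def m_assoc[symmetric])
    qed (use Cons in auto)
  qed auto
  have m: "free_lift G g (foldr push u v) = free_lift G g u \<otimes> free_lift G g v"
    if "fst ` set u \<subseteq> {..<n}" "fst ` set v \<subseteq> {..<n}" for u v
    using that
  proof (induction u)
    case Nil then show ?case using cl[of v] by (simp add: free_lift_def)
  next
    case (Cons a u)
    have "fst ` set (a # foldr push u v) \<subseteq> {..<n}"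
      using Cons.prems subset_trans[OF foldr_push_letters[of u v]] by simp
    then have "free_lift G g (foldr push (a # u) v) = free_lift G g (a # foldr push u v)"
      by (simp add: push)
    also have "\<dots> = free_lift G g (a # u) \<otimes> free_lift G g v"
    proof -
      have "free_lift G g (foldr push u v) = free_lift G g u \<otimes> free_lift G g v"
        using Cons by simp
      moreover have "g (fst a) \<in> carrier G" "free_lift G g u \<in> carrier G"
          "free_lift G g v \<in> carrier G"
        using Cons.prems g cl[of u] cl[of v] by simp_all
      ultimately show ?thesis by (simp add: step m_assoc)
    qed
    finally show ?case .
  qed
  show "free_lift G g \<in> hom (free_group n) G"
    using cl m by (auto simp: hom_def free_group_def)
  show "free_lift G g [(i, True)] = g i" if "i < n" for i
    using g[OF that] by (simp add: free_lift_def)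
qed


section \<open>Noncommutative formal power series\<close>

typedef 'k ncs = "UNIV :: (nat list \<Rightarrow> 'k) set"
  morphisms coeff Abs_ncs ..

lemma coeff_Abs [simp]: "coeff (Abs_ncs f) = f"
  by (simp add: Abs_ncs_inverse)

lemma ncs_eqI: "(\<And>w. coeff f w = coeff g w) \<Longrightarrow> f = g"
  by (simp add: coeff_inject[symmetric] ext)

instantiation ncs :: (ring_1) ring_1
begin
definition "0 = Abs_ncs (\<lambda>w. 0)"
definition "1 = Abs_ncs (\<lambda>w. if w = [] then 1 else 0)"
definition "f + g = Abs_ncs (\<lambda>w. coeff f w + coeff g w)"
definition "f - g = Abs_ncs (\<lambda>w. coeff f w - coeff g w)"
definition "- f = Abs_ncs (\<lambda>w. - coeff f w)"
definition "f * g = Abs_ncs (\<lambda>w. \<Sum>i=0..length w. coeff f (take i w) * coeff g (drop i w))"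

lemma coeff_simps [simp]:
  fixes f g :: "'a ncs"
  shows "coeff (0::'a ncs) w = 0" "coeff (1::'a ncs) w = (if w = [] then 1 else 0)"
    "coeff (f + g) w = coeff f w + coeff g w" "coeff (f - g) w = coeff f w - coeff g w"
    "coeff (- f) w = - coeff f w"
  by (simp_all add: zero_ncs_def one_ncs_def plus_ncs_def minus_ncs_def uminus_ncs_def)

lemma coeff_mult:
  fixes f g :: "'a ncs"
  shows "coeff (f * g) w = (\<Sum>i=0..length w. coeff f (take i w) * coeff g (drop i w))"
  by (simp add: times_ncs_def)

lemma triangle_sum:
  fixes k :: nat and f :: "nat \<Rightarrow> nat \<Rightarrow> nat \<Rightarrow> 'b::comm_monoid_add"
  shows "(\<Sum>j=0..k. \<Sum>i=0..j. f i (j - i) (n - j)) =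
         (\<Sum>j=0..k. \<Sum>i=0..k - j. f j i (n - j - i))"
  by (induct k) (simp_all add: Suc_diff_le sum.distrib add.assoc)

instance
proof
  fix a b c :: "'a ncs"
  show "a * b * c = a * (b * c)"
  proof (rule ncs_eqI)
    fix w :: "nat list"
    define n where "n = length w"
    define F where "F i p q = coeff a (take i w) * (coeff b (take p (drop i w)) * coeff c (drop (n - q) w))" for i p q
    have "coeff (a * b * c) w = (\<Sum>j=0..n. \<Sum>i=0..j. F i (j - i) (n - j))"
      unfolding coeff_mult n_def[symmetric]
    proof (rule sum.cong)
      fix j assume "j \<in> {0..n}"
      then have j: "j \<le> n" by simp
      then have l: "length (take j w) = j" by (simp add: n_def)
      show "(\<Sum>i=0..length (take j w). coeff a (take i (take j w)) * coeff b (drop i (take j w))) * coeff c (drop j w)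
          = (\<Sum>i=0..j. F i (j - i) (n - j))"
        unfolding l sum_distrib_right
        by (rule sum.cong) (use j in \<open>auto simp: F_def drop_take min_def mult.assoc\<close>)
    qed simp
    also have "\<dots> = (\<Sum>j=0..n. \<Sum>i=0..n - j. F j i (n - j - i))"
      by (rule triangle_sum)
    also have "\<dots> = coeff (a * (b * c)) w"
      unfolding coeff_mult n_def[symmetric]
    proof (rule sum.cong)
      fix j assume "j \<in> {0..n}"
      then have j: "j \<le> n" by simp
      then have l: "length (drop j w) = n - j" by (simp add: n_def)
      show "(\<Sum>i=0..n - j. F j i (n - j - i)) =
          coeff a (take j w) * (\<Sum>i=0..length (drop j w). coeff b (take i (drop j w)) * coeff c (drop i (drop j w)))"
        unfolding l sum_distrib_left
        by (rule sum.cong) (use j in \<open>auto simp: F_def add.commute\<close>)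
    qed simp
    finally show "coeff (a * b * c) w = coeff (a * (b * c)) w" .
  qed
  show "1 * a = a"
  proof (rule ncs_eqI)
    fix w
    have "coeff (1 * a) w = (\<Sum>i=0..length w. if i = 0 then coeff a w else 0)"
      unfolding coeff_mult by (rule sum.cong) auto
    then show "coeff (1 * a) w = coeff a w" by simp
  qed
  show "a * 1 = a"
  proof (rule ncs_eqI)
    fix w
    have "coeff (a * 1) w = (\<Sum>i=0..length w. if i = length w then coeff a w else 0)"
      unfolding coeff_mult by (rule sum.cong) auto
    then show "coeff (a * 1) w = coeff a w" by simp
  qed
  show "(a + b) * c = a * c + b * c" "a * (b + c) = a * b + a * c"
    by (rule ncs_eqI, simp add: coeff_mult distrib_left distrib_right sum.distrib)+
  show "(0::'a ncs) \<noteq> 1"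
  proof
    assume "(0::'a ncs) = 1"
    then have "coeff (0::'a ncs) [] = coeff 1 []" by simp
    then show False by simp
  qed
qed (rule ncs_eqI, simp add: algebra_simps)+
end

definition var :: "nat \<Rightarrow> 'k::ring_1 ncs" where
  "var i = Abs_ncs (\<lambda>w. if w = [i] then 1 else 0)"

definition scale :: "'k::ring_1 \<Rightarrow> 'k ncs \<Rightarrow> 'k ncs" where
  "scale c f = Abs_ncs (\<lambda>w. c * coeff f w)"

text \<open>The series \<open>\<Sum> f\<^sup>k / k!\<close> and \<open>\<Sum> (-1)\<^sup>k\<^sup>+\<^sup>1 (g - 1)\<^sup>k / k\<close>, for \<open>f\<close> with constant term \<open>0\<close>
  and \<open>g\<close> with constant term \<open>1\<close>: the terms with \<open>k\<close> larger than the length of \<open>w\<close> do not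
  contribute to the coefficient of \<open>w\<close>.\<close>

definition ncs_exp :: "'k::field_char_0 ncs \<Rightarrow> 'k ncs" where
  "ncs_exp f = Abs_ncs (\<lambda>w. \<Sum>k=0..length w. coeff (f ^ k) w / fact k)"

definition ncs_log :: "'k::field_char_0 ncs \<Rightarrow> 'k ncs" where
  "ncs_log g = Abs_ncs (\<lambda>w. \<Sum>k=1..length w. (-1) ^ (k + 1) * coeff ((g - 1) ^ k) w / of_nat k)"

definition bch :: "'k::field_char_0 ncs \<Rightarrow> 'k ncs \<Rightarrow> 'k ncs" where
  "bch f g = ncs_log (ncs_exp f * ncs_exp g)"

definition ncs_bracket :: "'k::ring_1 ncs \<Rightarrow> 'k ncs \<Rightarrow> 'k ncs" where
  "ncs_bracket f g = f * g - g * f"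


section \<open>The free Lie algebra\<close>

text \<open>The free Lie algebra on \<open>n\<close> generators, realised as the Lie algebra of Lie polynomials
  inside the free associative algebra. The theorem \<open>free_lie_universal\<close> below shows that it
  has the universal property of the free Lie algebra.\<close>

inductive_set free_lie :: "nat \<Rightarrow> 'k::field_char_0 ncs set" for n :: nat where
  var: "i < n \<Longrightarrow> var i \<in> free_lie n"
| zero: "0 \<in> free_lie n"
| add: "f \<in> free_lie n \<Longrightarrow> g \<in> free_lie n \<Longrightarrow> f + g \<in> free_lie n"
| scale: "f \<in> free_lie n \<Longrightarrow> scale c f \<in> free_lie n"
| bracket: "f \<in> free_lie n \<Longrightarrow> g \<in> free_lie n \<Longrightarrow> ncs_bracket f g \<in> free_lie n"

locale lie_algebra = vector_space scl
  for scl :: "'k::field_char_0 \<Rightarrow> 'b::ab_group_add \<Rightarrow> 'b" +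
  fixes br :: "'b \<Rightarrow> 'b \<Rightarrow> 'b"
  assumes br_add_left: "br (x + y) z = br x z + br y z"
    and br_add_right: "br x (y + z) = br x y + br x z"
    and br_scl_left: "br (scl c x) y = scl c (br x y)"
    and br_scl_right: "br x (scl c y) = scl c (br x y)"
    and br_self: "br x x = 0"
    and jacobi: "br x (br y z) + br y (br z x) + br z (br x y) = 0"

lemma coeff_scale [simp]: "coeff (scale c f) w = c * coeff f w"
  by (simp add: scale_def)

lemma coeff_var [simp]: "coeff (var i) w = (if w = [i] then 1 else 0)"
  by (simp add: var_def)

definition supp :: "'k::ring_1 ncs \<Rightarrow> nat list set" where
  "supp f = {w. coeff f w \<noteq> 0}"

definition mult_supp :: "nat list set \<Rightarrow> nat list set \<Rightarrow> nat list set" where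
  "mult_supp A B = (\<lambda>(u, v). u @ v) ` (A \<times> B)"

lemma finite_mult_supp: "finite A \<Longrightarrow> finite B \<Longrightarrow> finite (mult_supp A B)"
  by (simp add: mult_supp_def)

lemma supp_mult: "supp (f * g) \<subseteq> mult_supp (supp f) (supp g)"
proof
  fix w assume "w \<in> supp (f * g)"
  then have "(\<Sum>i=0..length w. coeff f (take i w) * coeff g (drop i w)) \<noteq> 0"
    by (simp add: supp_def coeff_mult)
  then obtain i where i: "coeff f (take i w) * coeff g (drop i w) \<noteq> 0"
    by (meson sum.not_neutral_contains_not_neutral)
  have "take i w \<in> supp f" "drop i w \<in> supp g"
    using i by (auto simp: supp_def)
  then have "(\<lambda>(u, v). u @ v) (take i w, drop i w) \<in> mult_supp (supp f) (supp g)"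
    unfolding mult_supp_def by (intro imageI) simp
  then show "w \<in> mult_supp (supp f) (supp g)" by simp
qed

context lie_algebra
begin

definition lin :: "(nat list \<Rightarrow> 'b) \<Rightarrow> 'k ncs \<Rightarrow> 'b" where
  "lin F f = (\<Sum>w\<in>supp f. scl (coeff f w) (F w))"

lemma lin_eq: "finite A \<Longrightarrow> supp f \<subseteq> A \<Longrightarrow> lin F f = (\<Sum>w\<in>A. scl (coeff f w) (F w))"
  unfolding lin_def by (rule sum.mono_neutral_left) (auto simp: supp_def)

lemma lin_cong: "(\<And>w. w \<in> supp f \<Longrightarrow> F w = F' w) \<Longrightarrow> lin F f = lin F' f"
  by (simp add: lin_def)

lemma lin_diff_fun: "lin (\<lambda>w. F w - F' w) f = lin F f - lin F' f"
  by (simp add: lin_def scale_right_diff_distrib sum_subtractf)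

lemma lin_scl_fun: "lin (\<lambda>w. scl c (F w)) f = scl c (lin F f)"
  by (simp add: lin_def scale_sum_right mult.commute)

lemma lin_add:
  assumes "finite (supp f)" "finite (supp g)"
  shows "lin F (f + g) = lin F f + lin F g"
proof -
  let ?A = "supp f \<union> supp g"
  have "supp (f + g) \<subseteq> ?A" by (auto simp: supp_def)
  then show ?thesis
    using assms by (simp add: lin_eq[of ?A] scale_left_distrib sum.distrib)
qed

lemma lin_diff:
  assumes "finite (supp f)" "finite (supp g)"
  shows "lin F (f - g) = lin F f - lin F g"
proof -
  let ?A = "supp f \<union> supp g"
  have "supp (f - g) \<subseteq> ?A" by (auto simp: supp_def)
  then show ?thesis
    using assms by (simp add: lin_eq[of ?A] scale_left_diff_distrib sum_subtractf)
qed

lemma lin_scale: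
  assumes "finite (supp f)"
  shows "lin F (scale c f) = scl c (lin F f)"
proof -
  have "supp (scale c f) \<subseteq> supp f" by (auto simp: supp_def)
  then show ?thesis
    using assms by (simp add: lin_eq[of "supp f"] scale_sum_right)
qed

lemma lin_var: "lin F (var i) = F [i]"
proof -
  have "supp (var i :: 'k ncs) = {[i]}" by (auto simp: supp_def)
  then show ?thesis by (simp add: lin_def)
qed

lemma lin_mult:
  assumes f: "finite (supp f)" and g: "finite (supp g)"
  shows "lin F (f * g) = lin (\<lambda>u. lin (\<lambda>v. F (u @ v)) g) f"
proof -
  let ?C = "mult_supp (supp f) (supp g)"
  let ?h = "\<lambda>(w, i). scl (coeff f (take i w) * coeff g (drop i w)) (F w)"
  let ?k = "\<lambda>(u, v). (u @ v, length u)"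
  have fin: "finite ?C" by (rule finite_mult_supp[OF f g])
  have "lin F (f * g) = (\<Sum>w\<in>?C. \<Sum>i=0..length w. ?h (w, i))"
    by (simp add: lin_eq[OF fin supp_mult] coeff_mult scale_sum_left)
  also have "\<dots> = sum ?h (SIGMA w:?C. {0..length w})"
    by (subst sum.Sigma) (auto simp: fin)
  also have "\<dots> = sum ?h (?k ` (supp f \<times> supp g))"
  proof (rule sum.mono_neutral_right)
    show "finite (SIGMA w:?C. {0..length w})" using fin by auto
    show "?k ` (supp f \<times> supp g) \<subseteq> (SIGMA w:?C. {0..length w})"
      by (auto simp: mult_supp_def)
    show "\<forall>p\<in>(SIGMA w:?C. {0..length w}) - ?k ` (supp f \<times> supp g). ?h p = 0"
    proof
      fix p assume p: "p \<in> (SIGMA w:?C. {0..length w}) - ?k ` (supp f \<times> supp g)"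
      obtain w i where wi: "p = (w, i)" "i \<le> length w" using p by auto
      have "coeff f (take i w) * coeff g (drop i w) = 0"
      proof (rule ccontr)
        assume "\<not> ?thesis"
        then have "(take i w, drop i w) \<in> supp f \<times> supp g" by (auto simp: supp_def)
        then have "?k (take i w, drop i w) \<in> ?k ` (supp f \<times> supp g)" by blast
        then show False using p wi by simp
      qed
      then show "?h p = 0" using wi by simp
    qed
  qed
  also have "\<dots> = sum (?h \<circ> ?k) (supp f \<times> supp g)"
    by (rule sum.reindex) (auto simp: inj_on_def)
  also have "\<dots> = (\<Sum>u\<in>supp f. \<Sum>v\<in>supp g. scl (coeff f u * coeff g v) (F (u @ v)))"
    by (simp add: sum.cartesian_product case_prod_beta)
  also have "\<dots> = lin (\<lambda>u. lin (\<lambda>v. F (u @ v)) g) f"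
    by (simp add: lin_def scale_sum_right)
  finally show ?thesis .
qed

lemma br_zero_right [simp]: "br x 0 = 0"
  using br_add_right[of x 0 0] by simp

lemma br_zero_left [simp]: "br 0 x = 0"
  using br_add_left[of 0 0 x] by simp

lemma br_minus_left: "br (- x) y = - br x y"
  using br_add_left[of x "- x" y] by (simp add: minus_unique)

lemma br_anti: "br y x = - br x y"
proof -
  have "br (x + y) (x + y) = 0" by (rule br_self)
  then have "br x x + br y x + (br x y + br y y) = 0"
    unfolding br_add_left br_add_right .
  then have "br y x + br x y = 0" by (simp add: br_self)
  then show ?thesis by (simp add: eq_neg_iff_add_eq_0)
qed

lemma br_minus_right: "br x (- y) = - br x y"
  using br_add_right[of x y "- y"] by (simp add: minus_unique)

lemma br_br: "br (br x y) z = br x (br y z) - br y (br x z)"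
proof -
  have "br y (br z x) = - br y (br x z)" by (subst br_anti) (rule br_minus_right)
  moreover have "br z (br x y) = - br (br x y) z" by (rule br_anti)
  ultimately show ?thesis using jacobi[of x y z] by (simp add: algebra_simps)
qed

lemma lin_br: "lin (\<lambda>v. br x (F v)) f = br x (lin F f)"
proof -
  have "br x (sum h A) = (\<Sum>v\<in>A. br x (h v))" if "finite A" for h and A :: "nat list set"
    using that by induction (auto simp: br_add_right)
  then show ?thesis
    by (cases "finite (supp f)") (auto simp: lin_def br_scl_right)
qed

end

datatype tree = Leaf nat | Node tree tree

primrec leaves :: "tree \<Rightarrow> nat" where
  "leaves (Leaf i) = 1"
| "leaves (Node s t) = leaves s + leaves t"

lemma leaves_pos: "leaves t > 0"
  by (induction t) auto

primrec eval_tree :: "('a \<Rightarrow> 'a \<Rightarrow> 'a) \<Rightarrow> (nat \<Rightarrow> 'a) \<Rightarrow> tree \<Rightarrow> 'a" where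
  "eval_tree b g (Leaf i) = g i"
| "eval_tree b g (Node s t) = b (eval_tree b g s) (eval_tree b g t)"

abbreviation mon :: "tree \<Rightarrow> 'k::field_char_0 ncs" where
  "mon \<equiv> eval_tree ncs_bracket var"

lemma supp_bracket:
  "supp (ncs_bracket f g) \<subseteq> mult_supp (supp f) (supp g) \<union> mult_supp (supp g) (supp f)"
proof -
  have "supp (ncs_bracket f g) \<subseteq> supp (f * g) \<union> supp (g * f)"
    by (auto simp: supp_def ncs_bracket_def)
  then show ?thesis using supp_mult[of f g] supp_mult[of g f] by blast
qed

lemma finite_supp_bracket:
  "finite (supp f) \<Longrightarrow> finite (supp g) \<Longrightarrow> finite (supp (ncs_bracket f g))"
  by (rule finite_subset[OF supp_bracket]) (simp add: finite_mult_supp)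

lemma finite_supp_simps:
  "finite (supp (0 :: 'k::ring_1 ncs))" "finite (supp (var i :: 'k ncs))"
  "finite (supp f) \<Longrightarrow> finite (supp g) \<Longrightarrow> finite (supp (f + g :: 'k ncs))"
  "finite (supp f) \<Longrightarrow> finite (supp (scale c f :: 'k ncs))"
proof -
  show "finite (supp (0 :: 'k ncs))" by (simp add: supp_def)
  show "finite (supp (var i :: 'k ncs))"
    by (rule finite_subset[of _ "{[i]}"]) (auto simp: supp_def)
  show "finite (supp (f + g :: 'k ncs))" if "finite (supp f)" "finite (supp g)"
    by (rule finite_subset[of _ "supp f \<union> supp g"]) (use that in \<open>auto simp: supp_def\<close>)
  show "finite (supp (scale c f :: 'k ncs))" if "finite (supp f)"
    by (rule finite_subset[of _ "supp f"]) (use that in \<open>auto simp: supp_def\<close>)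
qed

lemma finite_supp_mon: "finite (supp (mon t :: 'k::field_char_0 ncs))"
  by (induction t) (auto simp: finite_supp_simps finite_supp_bracket)

lemma length_supp_mon: "w \<in> supp (mon t :: 'k::field_char_0 ncs) \<Longrightarrow> length w = leaves t"
proof (induction t arbitrary: w)
  case (Node s t)
  then have "w \<in> mult_supp (supp (mon s :: 'k ncs)) (supp (mon t :: 'k ncs))
      \<union> mult_supp (supp (mon t :: 'k ncs)) (supp (mon s :: 'k ncs))"
    using supp_bracket[of "mon s :: 'k ncs" "mon t"] by auto
  then show ?case using Node.IH by (auto simp: mult_supp_def)
qed (auto simp: supp_def split: if_splits)

inductive_set mon_span :: "'k::field_char_0 ncs set" where
  zero: "0 \<in> mon_span"
| step: "f \<in> mon_span \<Longrightarrow> f + scale c (mon t) \<in> mon_span"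

lemma mon_span_add: "g \<in> mon_span \<Longrightarrow> f \<in> mon_span \<Longrightarrow> f + g \<in> mon_span"
  by (induction g rule: mon_span.induct) (auto simp: add.assoc[symmetric] intro: mon_span.step)

lemma scale_simps:
  fixes f g :: "'k::field_char_0 ncs"
  shows "scale c (f + g) = scale c f + scale c g" "scale c (scale d f) = scale (c * d) f"
    "scale c 0 = (0 :: 'k ncs)" "scale 1 f = f"
    "ncs_bracket (f + g) h = ncs_bracket f h + ncs_bracket g h"
    "ncs_bracket h (f + g) = ncs_bracket h f + ncs_bracket h g"
    "ncs_bracket (scale c f) g = scale c (ncs_bracket f g)"
    "ncs_bracket f (scale c g) = scale c (ncs_bracket f g)"
    "ncs_bracket 0 f = 0" "ncs_bracket f 0 = 0"
  by (auto intro!: ncs_eqI simp: ncs_bracket_def coeff_mult algebra_simps sum.distrib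
      sum_distrib_left)

lemma mon_span_scale: "f \<in> mon_span \<Longrightarrow> scale c f \<in> mon_span"
  by (induction f rule: mon_span.induct) (auto simp: scale_simps intro: mon_span.intros)

lemma mon_span_mon: "scale c (mon t) \<in> mon_span"
  using mon_span.step[OF mon_span.zero] by simp

lemma mon_span_bracket:
  assumes "f \<in> mon_span" "g \<in> mon_span"
  shows "ncs_bracket f g \<in> mon_span"
  using assms(1)
proof (induction f rule: mon_span.induct)
  case (step f c s)
  have "ncs_bracket (scale c (mon s)) g \<in> mon_span"
    using assms(2)
  proof (induction g rule: mon_span.induct)
    case (step g d t)
    have "ncs_bracket (scale c (mon s)) (scale d (mon t)) = scale (c * d) (mon (Node s t))"
      by (simp add: scale_simps mult.commute)
    then show ?case using step.IH mon_span_mon[of "c * d" "Node s t"]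
      by (simp add: scale_simps(6) mon_span_add)
  qed (auto simp: scale_simps mon_span.zero)
  then show ?case using step.IH by (simp add: scale_simps(5) mon_span_add)
qed (auto simp: scale_simps mon_span.zero)

lemma free_lie_mon_span: "f \<in> free_lie n \<Longrightarrow> f \<in> mon_span"
proof (induction f rule: free_lie.induct)
  case (var i)
  then show ?case using mon_span_mon[of 1 "Leaf i"] by (simp add: scale_simps)
qed (auto intro: mon_span.zero mon_span_add mon_span_scale mon_span_bracket)

lemma finite_supp_mon_span: "f \<in> mon_span \<Longrightarrow> finite (supp f)"
  by (induction f rule: mon_span.induct) (auto simp: finite_supp_simps finite_supp_mon)

lemma finite_supp_free_lie: "f \<in> free_lie n \<Longrightarrow> finite (supp f)"
  by (rule finite_supp_mon_span[OF free_lie_mon_span])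

context lie_algebra
begin

fun right_br :: "(nat \<Rightarrow> 'b) \<Rightarrow> nat list \<Rightarrow> 'b" where
  "right_br g [] = 0"
| "right_br g [i] = g i"
| "right_br g (i # w) = br (g i) (right_br g w)"

definition ad_word :: "(nat \<Rightarrow> 'b) \<Rightarrow> nat list \<Rightarrow> 'b \<Rightarrow> 'b" where
  "ad_word g w y = foldr (\<lambda>i y. br (g i) y) w y"

lemma right_br_append: "v \<noteq> [] \<Longrightarrow> right_br g (u @ v) = ad_word g u (right_br g v)"
proof (induction u)
  case (Cons i u)
  then have "right_br g ((i # u) @ v) = br (g i) (right_br g (u @ v))"
    by (cases "u @ v") auto
  then show ?case using Cons by (simp add: ad_word_def)
qed (simp add: ad_word_def)

lemma ad_word_append: "ad_word g (u @ v) y = ad_word g u (ad_word g v y)"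
  by (simp add: ad_word_def)

lemma lin_ad_word: "lin (\<lambda>v. ad_word g u (F v)) f = ad_word g u (lin F f)"
  by (induction u arbitrary: F) (auto simp: ad_word_def lin_br)

abbreviation ev :: "(nat \<Rightarrow> 'b) \<Rightarrow> tree \<Rightarrow> 'b" where
  "ev g \<equiv> eval_tree br g"

lemma lin_bracket:
  assumes "finite (supp f)" "finite (supp h)"
  shows "lin F (ncs_bracket f h) =
    lin (\<lambda>u. lin (\<lambda>v. F (u @ v)) h) f - lin (\<lambda>u. lin (\<lambda>v. F (u @ v)) f) h"
proof -
  have "finite (supp (f * h))" "finite (supp (h * f))"
    by (meson assms finite_mult_supp finite_subset supp_mult)+
  then show ?thesis using assms by (simp add: ncs_bracket_def lin_diff lin_mult)
qed

lemma ad_mon: "lin (\<lambda>w. ad_word g w y) (mon t) = br (ev g t) y"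
proof (induction t arbitrary: y)
  case (Leaf i)
  then show ?case by (simp add: lin_var ad_word_def)
next
  case (Node s t)
  then show ?case
    by (simp add: lin_bracket finite_supp_mon ad_word_append lin_ad_word br_br)
qed

lemma right_br_mon: "lin (right_br g) (mon t) = scl (of_nat (leaves t)) (ev g t)"
proof (induction t)
  case (Leaf i)
  then show ?case by (simp add: lin_var)
next
  case (Node s t)
  have *: "lin (\<lambda>u. lin (\<lambda>v. right_br g (u @ v)) (mon b)) (mon a)
      = br (ev g a) (lin (right_br g) (mon b))" for a b
  proof -
    have "lin (\<lambda>v. right_br g (u @ v)) (mon b) = ad_word g u (lin (right_br g) (mon b))" for u
    proof -
      have "v \<noteq> []" if "v \<in> supp (mon b :: 'k ncs)" for v
        using length_supp_mon[OF that] leaves_pos[of b] by auto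
      then have "lin (\<lambda>v. right_br g (u @ v)) (mon b) = lin (\<lambda>v. ad_word g u (right_br g v)) (mon b)"
        by (intro lin_cong) (simp add: right_br_append)
      then show ?thesis by (simp add: lin_ad_word)
    qed
    then show ?thesis by (simp add: ad_mon)
  qed
  have "lin (right_br g) (mon (Node s t)) =
      br (ev g s) (lin (right_br g) (mon t)) - br (ev g t) (lin (right_br g) (mon s))"
    by (simp add: lin_bracket finite_supp_mon *)
  also have "\<dots> = scl (of_nat (leaves t)) (br (ev g s) (ev g t))
      - scl (of_nat (leaves s)) (br (ev g t) (ev g s))"
    by (simp add: Node br_scl_right)
  also have "\<dots> = scl (of_nat (leaves (Node s t))) (ev g (Node s t))"
    by (subst br_anti[of "ev g t" "ev g s"]) (simp add: scale_left_distrib)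
  finally show ?case .
qed

definition ext :: "(nat \<Rightarrow> 'b) \<Rightarrow> 'k ncs \<Rightarrow> 'b" where
  "ext g = lin (\<lambda>w. scl (1 / of_nat (length w)) (right_br g w))"

lemma ext_mon: "ext g (mon t) = ev g t"
proof -
  have "ext g (mon t) = lin (\<lambda>w. scl (1 / of_nat (leaves t)) (right_br g w)) (mon t)"
    unfolding ext_def by (rule lin_cong) (simp add: length_supp_mon)
  then show ?thesis using leaves_pos[of t] by (simp add: lin_scl_fun right_br_mon)
qed

lemma ext_add: "finite (supp f) \<Longrightarrow> finite (supp h) \<Longrightarrow> ext g (f + h) = ext g f + ext g h"
  by (simp add: ext_def lin_add)

lemma ext_scale: "finite (supp f) \<Longrightarrow> ext g (scale c f) = scl c (ext g f)"
  by (simp add: ext_def lin_scale)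

lemma ext_zero: "ext g 0 = 0"
  by (simp add: ext_def lin_def supp_def)

lemmas fin_simps = finite_supp_simps finite_supp_mon finite_supp_bracket finite_supp_mon_span

lemma ext_bracket:
  assumes "f \<in> mon_span" "h \<in> mon_span"
  shows "ext g (ncs_bracket f h) = br (ext g f) (ext g h)"
  using assms(1)
proof (induction f rule: mon_span.induct)
  case (step f c s)
  have "ext g (ncs_bracket (mon s) h) = br (ext g (mon s)) (ext g h)"
    using assms(2)
  proof (induction h rule: mon_span.induct)
    case (step h d t)
    then show ?case
      using ext_mon[of g "Node s t"]
      by (simp add: scale_simps ext_add ext_scale ext_mon fin_simps br_add_right br_scl_right)
  qed (simp add: scale_simps ext_zero)
  then show ?case using step assms(2)
    by (simp add: scale_simps ext_add ext_scale fin_simps br_add_left br_scl_left)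
qed (simp add: scale_simps ext_zero)

definition lie_hom_on :: "nat \<Rightarrow> (nat \<Rightarrow> 'b) \<Rightarrow> ('k ncs \<Rightarrow> 'b) \<Rightarrow> bool" where
  "lie_hom_on n g \<phi> \<longleftrightarrow>
     (\<forall>f\<in>free_lie n. \<forall>h\<in>free_lie n. \<phi> (f + h) = \<phi> f + \<phi> h) \<and>
     (\<forall>c. \<forall>f\<in>free_lie n. \<phi> (scale c f) = scl c (\<phi> f)) \<and>
     (\<forall>f\<in>free_lie n. \<forall>h\<in>free_lie n. \<phi> (ncs_bracket f h) = br (\<phi> f) (\<phi> h)) \<and>
     (\<forall>i<n. \<phi> (var i) = g i)"

theorem free_lie_universal:
  shows "\<exists>\<phi>. lie_hom_on n g \<phi>"
    and "lie_hom_on n g \<phi> \<Longrightarrow> lie_hom_on n g \<psi> \<Longrightarrow> f \<in> free_lie n \<Longrightarrow> \<phi> f = \<psi> f"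
proof -
  have "ext g (var i) = g i" for i using ext_mon[of g "Leaf i"] by simp
  then have "lie_hom_on n g (ext g)"
    by (simp add: lie_hom_on_def ext_add ext_scale ext_bracket free_lie_mon_span
        finite_supp_free_lie)
  then show "\<exists>\<phi>. lie_hom_on n g \<phi>" by blast
next
  assume \<phi>: "lie_hom_on n g \<phi>" and \<psi>: "lie_hom_on n g \<psi>" and "f \<in> free_lie n"
  from this(3) show "\<phi> f = \<psi> f"
  proof (induction f rule: free_lie.induct)
    case zero
    have "\<phi> (scale 0 0) = scl 0 (\<phi> 0)" "\<psi> (scale 0 0) = scl 0 (\<psi> 0)"
      using \<phi> \<psi> free_lie.zero unfolding lie_hom_on_def by blast+
    then show ?case by (simp add: scale_simps)
  qed (use \<phi> \<psi> in \<open>simp_all add: lie_hom_on_def\<close>)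
qed

end

section \<open>Filtered complete Lie algebras\<close>

record ('k, 'a) filtered_lie =
  lcarrier :: "'a set"
  lzero :: 'a
  ladd :: "'a \<Rightarrow> 'a \<Rightarrow> 'a"
  lscale :: "'k \<Rightarrow> 'a \<Rightarrow> 'a"
  lbracket :: "'a \<Rightarrow> 'a \<Rightarrow> 'a"
  lfilt :: "nat \<Rightarrow> 'a set"

definition lie_ideal :: "('k, 'a) filtered_lie \<Rightarrow> 'a set \<Rightarrow> bool" where
  "lie_ideal L I \<longleftrightarrow> I \<subseteq> lcarrier L \<and> lzero L \<in> I \<and>
     (\<forall>x\<in>I. \<forall>y\<in>I. ladd L x y \<in> I) \<and> (\<forall>c. \<forall>x\<in>I. lscale L c x \<in> I) \<and>
     (\<forall>x\<in>lcarrier L. \<forall>y\<in>I. lbracket L x y \<in> I)"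

text \<open>Closed in the topology in which the \<open>lfilt L d\<close> are a neighbourhood basis of \<open>0\<close>.\<close>

definition filt_closed :: "('k, 'a) filtered_lie \<Rightarrow> 'a set \<Rightarrow> bool" where
  "filt_closed L I \<longleftrightarrow>
     (\<forall>x\<in>lcarrier L. (\<forall>d. \<exists>y\<in>I. \<exists>z\<in>lfilt L d. x = ladd L y z) \<longrightarrow> x \<in> I)"

definition closed_ideal :: "('k, 'a) filtered_lie \<Rightarrow> 'a set \<Rightarrow> 'a set" where
  "closed_ideal L S = \<Inter>{I. lie_ideal L I \<and> filt_closed L I \<and> S \<subseteq> I}"

definition lie_coset :: "('k, 'a) filtered_lie \<Rightarrow> 'a set \<Rightarrow> 'a \<Rightarrow> 'a set" where
  "lie_coset L I x = ladd L x ` I"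

definition lie_quotient :: "('k, 'a) filtered_lie \<Rightarrow> 'a set \<Rightarrow> ('k, 'a set) filtered_lie" where
  "lie_quotient L I =
     \<lparr>lcarrier = lie_coset L I ` lcarrier L,
      lzero = I,
      ladd = (\<lambda>A B. \<Union>a\<in>A. \<Union>b\<in>B. lie_coset L I (ladd L a b)),
      lscale = (\<lambda>c A. \<Union>a\<in>A. lie_coset L I (lscale L c a)),
      lbracket = (\<lambda>A B. \<Union>a\<in>A. \<Union>b\<in>B. lie_coset L I (lbracket L a b)),
      lfilt = (\<lambda>d. lie_coset L I ` lfilt L d)\<rparr>"

definition filtered_lie_iso ::
    "('k, 'a) filtered_lie \<Rightarrow> ('k, 'b) filtered_lie \<Rightarrow> ('a \<Rightarrow> 'b) \<Rightarrow> bool" where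
  "filtered_lie_iso L M \<phi> \<longleftrightarrow>
     bij_betw \<phi> (lcarrier L) (lcarrier M) \<and>
     (\<forall>x\<in>lcarrier L. \<forall>y\<in>lcarrier L. \<phi> (ladd L x y) = ladd M (\<phi> x) (\<phi> y)) \<and>
     (\<forall>c. \<forall>x\<in>lcarrier L. \<phi> (lscale L c x) = lscale M c (\<phi> x)) \<and>
     (\<forall>x\<in>lcarrier L. \<forall>y\<in>lcarrier L. \<phi> (lbracket L x y) = lbracket M (\<phi> x) (\<phi> y)) \<and>
     (\<forall>d. \<phi> ` lfilt L d = lfilt M d)"

text \<open>The completion \<open>E\<^sub>n\<close> of the free Lie algebra with respect to degree, i.e. its closure in the
  algebra of power series; the filtration is by least degree.\<close>

definition free_complete_lie_set :: "nat \<Rightarrow> 'k::field_char_0 ncs set" where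
  "free_complete_lie_set n =
     {f. \<forall>d. \<exists>p\<in>free_lie n. \<forall>w. length w < d \<longrightarrow> coeff f w = coeff p w}"

definition free_complete_lie :: "nat \<Rightarrow> ('k::field_char_0, 'k ncs) filtered_lie" where
  "free_complete_lie n =
     \<lparr>lcarrier = free_complete_lie_set n, lzero = 0, ladd = (+), lscale = scale,
      lbracket = ncs_bracket,
      lfilt = (\<lambda>d. {f \<in> free_complete_lie_set n. \<forall>w. length w < d \<longrightarrow> coeff f w = 0})\<rparr>"


section \<open>Malcev Lie algebras and 1-formality\<close>

definition exp_group :: "nat \<Rightarrow> 'k::field_char_0 ncs monoid" where
  "exp_group n = \<lparr>carrier = free_complete_lie_set n, mult = bch, one = 0\<rparr>"

text \<open>As \<open>exp(E\<^sub>n)\<close> is the set \<open>E\<^sub>n\<close> with a group structure, \<open>e\<^sup>x\<close> is \<open>x\<close> regarded as an element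
  of the group, and \<open>\<sigma>\<^sub>n(r)\<close>, regarded as an element of \<open>E\<^sub>n\<close>, is its logarithm.\<close>

definition sigma :: "nat \<Rightarrow> letter list \<Rightarrow> 'k::field_char_0 ncs" where
  "sigma n = free_lift (exp_group n) var"

definition malcev_lie ::
    "nat \<Rightarrow> letter list set \<Rightarrow> ('k::field_char_0, 'k ncs set) filtered_lie" where
  "malcev_lie n R =
     lie_quotient (free_complete_lie n) (closed_ideal (free_complete_lie n) (sigma n ` R))"

definition homogeneous :: "nat \<Rightarrow> 'k::field_char_0 ncs \<Rightarrow> bool" where
  "homogeneous d f \<longleftrightarrow> (\<forall>w. coeff f w \<noteq> 0 \<longrightarrow> length w = d)"

definition quadratic :: "('k::field_char_0, 'a) filtered_lie \<Rightarrow> bool" where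
  "quadratic L \<longleftrightarrow>
     (\<exists>m S \<phi>. S \<subseteq> lcarrier (free_complete_lie m :: ('k, 'k ncs) filtered_lie) \<and>
        (\<forall>f\<in>S. homogeneous 2 f) \<and>
        filtered_lie_iso L
          (lie_quotient (free_complete_lie m) (closed_ideal (free_complete_lie m) S)) \<phi>)"

text \<open>The Malcev Lie algebra does not depend on the presentation up to isomorphism; here
  the condition is imposed for every finite presentation of \<open>G\<close>.\<close>

definition one_formal :: "'k::field_char_0 itself \<Rightarrow> ('g, 'b) monoid_scheme \<Rightarrow> bool" where
  "one_formal K G \<longleftrightarrow>
     (\<exists>n R \<pi>. finite_presentation G n R \<pi>) \<and>
     (\<forall>n R \<pi>. finite_presentation G n R \<pi> \<longrightarrow>
        quadratic (malcev_lie n R :: ('k, 'k ncs set) filtered_lie))"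

end

theory Submission
  imports Defs "HOL-Computational_Algebra.Formal_Power_Series"
begin

text \<open>Let \<open>I\<close> be the closed ideal generated by the logarithms of the relators, so that the Malcev
  Lie algebra is \<open>E\<^sub>n / I\<close>. For Lie series \<open>x\<close>, \<open>y\<close>, conjugation by \<open>e\<^sup>x\<close> acts as
  \<open>exp (ad x)\<close>, so the logarithm of \<open>[e\<^sup>x, e\<^sup>y]\<close> lies in \<open>I\<close> iff \<open>(exp (ad x) - 1) y\<close> does. This
  element is \<open>\<Phi> (ad x) [x, y]\<close> for the power series \<open>\<Phi> t = (e\<^sup>t - 1) / t\<close>, which starts with \<open>1\<close>;
  as \<open>ad x\<close> raises the degree and \<open>I\<close> is closed, \<open>\<Phi> (ad x)\<close> can be inverted modulo \<open>I\<close>, and the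
  condition becomes \<open>[x, y] \<in> I\<close> (\<open>commutator_in_ideal_iff\<close>). For single letters this says that the
  relator \<open>[x\<^sub>i, x\<^sub>j]\<close> may be replaced by the quadratic element \<open>[var i, var j]\<close>. Once these brackets
  are in \<open>I\<close>, the Campbell-Baker-Hausdorff product of the letters of a positive word is congruent
  to their sum (\<open>bch_cong_add\<close>, \<open>sigma_pos_word_cong\<close>), so a relator \<open>[x\<^sub>1\<cdots>x\<^sub>m, y\<^sub>1\<cdots>y\<^sub>l]\<close> may be
  replaced by \<open>[\<Sum> x\<^sub>i, \<Sum> y\<^sub>j]\<close>. Hence \<open>I\<close> is generated by its homogeneous elements of degree \<open>2\<close>
  (\<open>malcev_ideal_quadratic\<close>).

  For the argument to make sense, logarithms of products have to be Lie series. This is the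
  Campbell-Baker-Hausdorff theorem, obtained here from the derivation that multiplies each component
  by its degree. It also shows that the group law on \<open>E\<^sub>n\<close> is given by a universal Lie series in two
  variables, and therefore descends to \<open>E\<^sub>n / I\<close> (\<open>bch_cong\<close>).

  \<open>1\<close>-formality quantifies over all finite presentations, so the Malcev Lie algebra must also be shown
  to be independent of the presentation (\<open>malcev_lie_presentation_independent\<close>): expressing the
  generators of one presentation as words in the generators of the other defines continuous Lie
  homomorphisms in both directions. They respect the ideals and are mutually inverse modulo them,
  because words with the same image in the group have congruent logarithms (\<open>sigma_cong\<close>).\<close>

section \<open>Convergence in the algebra of power series\<close>

text \<open>Every argument about convergence is phrased through equality below degree \<open>d\<close>. In particular,
  \<open>agree d f 0\<close> expresses that \<open>f\<close> has order at least \<open>d\<close>.\<close>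

definition agree :: "nat \<Rightarrow> 'k::field_char_0 ncs \<Rightarrow> 'k ncs \<Rightarrow> bool" where
  "agree d f g \<longleftrightarrow> (\<forall>w. length w < d \<longrightarrow> coeff f w = coeff g w)"

lemma agree_refl [simp]: "agree d f f"
  by (simp add: agree_def)

lemma agree_sym: "agree d f g \<Longrightarrow> agree d g f"
  by (simp add: agree_def)

lemma agree_trans [trans]: "agree d f g \<Longrightarrow> agree d g h \<Longrightarrow> agree d f h"
  by (simp add: agree_def)

lemma agree_mono: "agree e f g \<Longrightarrow> d \<le> e \<Longrightarrow> agree d f g"
  by (simp add: agree_def)

lemma agree_zero_degree [simp]: "agree 0 f g"
  by (simp add: agree_def)

lemma agree_1_iff: "agree (Suc 0) f g \<longleftrightarrow> coeff f [] = coeff g []"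
  by (simp add: agree_def)

lemma agree_eqI: "(\<And>d. agree d f g) \<Longrightarrow> f = g"
  by (rule ncs_eqI) (meson agree_def lessI)

lemma agree_add: "agree d f f' \<Longrightarrow> agree d g g' \<Longrightarrow> agree d (f + g) (f' + g')"
  by (simp add: agree_def)

lemma agree_diff: "agree d f f' \<Longrightarrow> agree d g g' \<Longrightarrow> agree d (f - g) (f' - g')"
  by (simp add: agree_def)

lemma agree_scale: "agree d f f' \<Longrightarrow> agree d (scale c f) (scale c f')"
  by (simp add: agree_def)

lemma agree_scale_zero: "agree d f 0 \<Longrightarrow> agree d (scale c f) 0"
  by (simp add: agree_def)

lemma agree_iff_diff: "agree d f g \<longleftrightarrow> agree d (f - g) 0"
  by (simp add: agree_def)

lemma coeff_sum: "coeff (sum s A) w = (\<Sum>a\<in>A. coeff (s a) w)"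
  by (induction A rule: infinite_finite_induct) auto

lemma agree_sum: "(\<And>a. a \<in> A \<Longrightarrow> agree d (s a) (t a)) \<Longrightarrow> agree d (sum s A) (sum t A)"
  by (simp add: agree_def coeff_sum)

lemma agree_sum_zero: "(\<And>a. a \<in> A \<Longrightarrow> agree d (s a) 0) \<Longrightarrow> agree d (sum s A) 0"
  by (simp add: agree_def coeff_sum)

lemma agree_mult_zero:
  assumes "agree a f 0" "agree b g 0"
  shows "agree (a + b) (f * g) 0"
  unfolding agree_def
proof (intro allI impI)
  fix w :: "nat list" assume w: "length w < a + b"
  have "coeff f (take i w) * coeff g (drop i w) = 0" if "i \<in> {0..length w}" for i
    using assms w that by (cases "i < a") (auto simp: agree_def)
  then show "coeff (f * g) w = coeff 0 w" by (simp add: coeff_mult del: mult_eq_0_iff)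
qed

lemma agree_mult:
  assumes "agree d f f'" "agree d g g'"
  shows "agree d (f * g) (f' * g')"
proof -
  have "agree (d + 0) ((f - f') * g) 0" "agree (0 + d) (f' * (g - g')) 0"
    using assms agree_iff_diff by (blast intro: agree_mult_zero agree_zero_degree)+
  then have "agree d ((f - f') * g + f' * (g - g')) (0 + 0)"
    by (intro agree_add) simp_all
  then show ?thesis by (subst agree_iff_diff) (simp add: algebra_simps)
qed

text \<open>Multiplying by series without constant term gains one degree of precision; this is what
  makes every recursion below converge.\<close>

lemma agree_mult_Suc:
  assumes "agree d f f'" "agree d g g'" "coeff f' [] = 0" "coeff g [] = 0"
  shows "agree (Suc d) (f * g) (f' * g')"
proof -
  have "agree d (f - f') 0" "agree d (g - g') 0"
    using assms(1,2) agree_iff_diff by blast+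
  then have "agree (d + 1) ((f - f') * g) 0" "agree (1 + d) (f' * (g - g')) 0"
    using assms(3,4) by (intro agree_mult_zero; simp add: agree_1_iff)+
  then have "agree (Suc d) ((f - f') * g + f' * (g - g')) (0 + 0)"
    by (intro agree_add) simp_all
  then show ?thesis by (subst agree_iff_diff) (simp add: algebra_simps)
qed

lemma agree_bracket:
  "agree d f f' \<Longrightarrow> agree d g g' \<Longrightarrow> agree d (ncs_bracket f g) (ncs_bracket f' g')"
  by (simp add: ncs_bracket_def agree_mult agree_diff)

lemma agree_bracket_Suc:
  "\<lbrakk>agree d f f'; agree d g g'; coeff f [] = 0; coeff f' [] = 0; coeff g [] = 0; coeff g' [] = 0\<rbrakk>
    \<Longrightarrow> agree (Suc d) (ncs_bracket f g) (ncs_bracket f' g')"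
  by (simp add: ncs_bracket_def agree_mult_Suc agree_diff)

lemma agree_power_zero: "coeff f [] = 0 \<Longrightarrow> agree k (f ^ k) 0"
proof (induction k)
  case (Suc k)
  then show ?case using agree_mult_zero[of 1 f k "f ^ k"] by (simp add: agree_1_iff)
qed simp

lemma coeff_mult_Nil [simp]: "coeff (f * g) [] = coeff f [] * coeff g []"
  by (simp add: coeff_mult)

lemma coeff_bracket_Nil [simp]:
  "coeff (ncs_bracket f g) [] = (0 :: 'k::field_char_0)"
  by (simp add: ncs_bracket_def)

lemma coeff_power_Nil [simp]: "coeff (f ^ k) [] = coeff f [] ^ k"
  by (induction k) auto

lemma scale_algebra:
  fixes f g :: "'k::field_char_0 ncs"
  shows "scale c f * g = scale c (f * g)" "f * scale c g = scale c (f * g)"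
    "scale c (- f) = - scale c f" "scale c (f - g) = scale c f - scale c g"
    "scale (a + b) f = scale a f + scale b f" "scale (-1) f = - f" "scale 0 f = 0"
    "scale c (sum s A) = (\<Sum>a\<in>A. scale c (s a))"
  by (auto intro!: ncs_eqI simp: coeff_mult coeff_sum sum_distrib_left algebra_simps)

lemma scale_power: "scale (c :: 'k::field_char_0) f ^ k = scale (c ^ k) (f ^ k)"
  by (induction k) (auto simp: scale_algebra scale_simps mult.commute)

text \<open>This is the sum of the series \<open>s k\<close> provided that \<open>s k\<close> has order at least \<open>k\<close>: the omitted terms
  then do not contribute to the coefficient of \<open>w\<close>.\<close>

definition isum :: "(nat \<Rightarrow> 'k::field_char_0 ncs) \<Rightarrow> 'k ncs" where
  "isum s = Abs_ncs (\<lambda>w. \<Sum>k\<le>length w. coeff (s k) w)"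

lemma coeff_isum: "coeff (isum s) w = (\<Sum>k\<le>length w. coeff (s k) w)"
  by (simp add: isum_def)

lemma agree_isum_partial:
  assumes "\<And>k. agree k (s k) 0" "d \<le> N"
  shows "agree d (isum s) (\<Sum>k<N. s k)"
  unfolding agree_def
proof (intro allI impI)
  fix w :: "nat list" assume w: "length w < d"
  have "(\<Sum>k<N. coeff (s k) w) = (\<Sum>k\<le>length w. coeff (s k) w)"
    by (rule sum.mono_neutral_right) (use w assms in \<open>auto simp: agree_def\<close>)
  then show "coeff (isum s) w = coeff (\<Sum>k<N. s k) w" by (simp add: coeff_isum coeff_sum)
qed

lemma agree_isum_cong: "(\<And>k. agree d (s k) (t k)) \<Longrightarrow> agree d (isum s) (isum t)"
  by (simp add: agree_def coeff_isum)

lemma isum_add: "isum (\<lambda>k. s k + t k) = isum s + isum t"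
  by (rule ncs_eqI) (simp add: coeff_isum sum.distrib)

lemma isum_scale: "isum (\<lambda>k. scale c (s k)) = scale c (isum s)"
  by (rule ncs_eqI) (simp add: coeff_isum sum_distrib_left)

text \<open>A continuous additive map commutes with convergent sums, because it commutes with the finite partial
  sums. Multiplication, the Euler derivation and substitution are treated in this way.\<close>

lemma isum_additive:
  assumes s: "\<And>k. agree k (s k) 0" and Fs: "\<And>k. agree k (F (s k)) 0"
    and cont: "\<And>d f g. agree d f g \<Longrightarrow> agree d (F f) (F g)"
    and add: "\<And>f g. F (f + g) = F f + F g"
  shows "F (isum s) = isum (\<lambda>k. F (s k))"
proof (rule agree_eqI)
  fix d
  have "F 0 = 0" using add[of 0 0] by simp
  then have "F (\<Sum>k<d. s k) = (\<Sum>k<d. F (s k))" by (induction d) (auto simp: add)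
  then have "agree d (F (isum s)) (\<Sum>k<d. F (s k))"
    using cont[OF agree_isum_partial[of s d d]] s by simp
  then show "agree d (F (isum s)) (isum (\<lambda>k. F (s k)))"
    using agree_isum_partial[of "\<lambda>k. F (s k)" d d] Fs agree_sym agree_trans by blast
qed

lemma isum_mult_left:
  assumes "\<And>k. agree k (s k) 0"
  shows "g * isum s = isum (\<lambda>k. g * s k)"
proof (rule isum_additive)
  show "agree k (g * s k) 0" for k using agree_mult_zero[of 0 g k "s k"] assms by simp
qed (use assms in \<open>auto simp: distrib_left intro: agree_mult\<close>)

lemma isum_mult_right:
  assumes "\<And>k. agree k (s k) 0"
  shows "isum s * g = isum (\<lambda>k. s k * g)"
proof (rule isum_additive[where F = "\<lambda>f. f * g"])
  show "agree k (s k * g) 0" for k using agree_mult_zero[of k "s k" 0 g] assms by simp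
qed (use assms in \<open>auto simp: distrib_right intro: agree_mult\<close>)

lemma isum_first:
  assumes "\<And>k. agree k (s k) 0"
  shows "isum s = s 0 + isum (\<lambda>k. s (Suc k))"
proof (rule agree_eqI)
  fix d
  have "agree d (s (Suc k)) 0" if "d \<le> k" for k using assms[of "Suc k"] that agree_mono by fastforce
  moreover have "agree k (s (Suc k)) 0" for k using assms[of "Suc k"] agree_mono by fastforce
  ultimately have "agree d (isum (\<lambda>k. s (Suc k))) (\<Sum>k<d. s (Suc k))"
    by (intro agree_isum_partial) auto
  then have "agree d (s 0 + isum (\<lambda>k. s (Suc k))) (\<Sum>k<Suc d. s k)"
    unfolding sum.lessThan_Suc_shift by (intro agree_add) auto
  then show "agree d (isum s) (s 0 + isum (\<lambda>k. s (Suc k)))"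
    using agree_isum_partial[of s d "Suc d"] assms agree_sym agree_trans by fastforce
qed

text \<open>The Cauchy product. Modulo order \<open>d\<close> the partial sums may be taken over the square \<open>i, j < d\<close>, and
  its part outside the triangle \<open>i + j < d\<close> has order at least \<open>d\<close>.\<close>

lemma isum_mult_isum:
  assumes s: "\<And>k. agree k (s k) 0" and t: "\<And>k. agree k (t k) 0"
  shows "isum s * isum t = isum (\<lambda>k. \<Sum>i\<le>k. s i * t (k - i))"
proof (rule agree_eqI)
  fix d
  have st: "agree (i + j) (s i * t j) 0" for i j by (rule agree_mult_zero[OF s t])
  have u: "agree k (\<Sum>i\<le>k. s i * t (k - i)) 0" for k
  proof (rule agree_sum_zero)
    show "agree k (s i * t (k - i)) 0" if "i \<in> {..k}" for i
      using st[of i "k - i"] that by simp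
  qed
  have "agree d (isum s * isum t) ((\<Sum>i<d. s i) * (\<Sum>j<d. t j))"
    using s t by (intro agree_mult agree_isum_partial) auto
  also have "(\<Sum>i<d. s i) * (\<Sum>j<d. t j) = (\<Sum>(i,j)\<in>{..<d}\<times>{..<d}. s i * t j)"
    by (simp add: sum_product sum.cartesian_product)
  also have "\<dots> = (\<Sum>(i,j)\<in>{(i,j). i + j < d}. s i * t j)
      + (\<Sum>(i,j)\<in>{..<d}\<times>{..<d} - {(i,j). i + j < d}. s i * t j)" (is "_ = ?low + ?high")
    by (subst add.commute, rule sum.subset_diff) auto
  finally have "agree d (isum s * isum t) (?low + ?high)" .
  moreover have "agree d (?low + ?high) (?low + 0)"
  proof (intro agree_add agree_refl)
    show "agree d ?high 0"
    proof (rule agree_sum_zero)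
      fix p assume "p \<in> {..<d}\<times>{..<d} - {(i,j). i + j < d}"
      then show "agree d (case p of (i, j) \<Rightarrow> s i * t j) 0"
        using agree_mono[OF st[of "fst p" "snd p"], of d] by (auto simp: case_prod_beta)
    qed
  qed
  ultimately have "agree d (isum s * isum t) ?low"
    using agree_trans by fastforce
  also have "?low = (\<Sum>k<d. \<Sum>i\<le>k. s i * t (k - i))"
    by (rule sum.triangle_reindex)
  also have "agree d (\<Sum>k<d. \<Sum>i\<le>k. s i * t (k - i)) (isum (\<lambda>k. \<Sum>i\<le>k. s i * t (k - i)))"
    by (rule agree_sym, rule agree_isum_partial[OF u order_refl])
  finally show "agree d (isum s * isum t) (isum (\<lambda>k. \<Sum>i\<le>k. s i * t (k - i)))" .
qed

lemma isum_single: "isum (\<lambda>k. if k = 0 then f else 0) = f"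
proof (rule ncs_eqI)
  fix w
  have "(\<Sum>k\<le>length w. coeff (if k = 0 then f else 0) w) = (\<Sum>k\<le>length w. if k = 0 then coeff f w else 0)"
    by (rule sum.cong) auto
  then show "coeff (isum (\<lambda>k. if k = 0 then f else 0)) w = coeff f w"
    by (simp add: coeff_isum)
qed

section \<open>Exponential and logarithm\<close>

text \<open>Evaluation of a power series in one variable at a noncommutative series without constant term
  is a ring homomorphism compatible with composition. Identities for \<open>exp\<close> and \<open>log\<close>
  are thereby reduced to known ones between formal power series in one commuting variable.\<close>

definition fps_eval :: "'k::field_char_0 fps \<Rightarrow> 'k ncs \<Rightarrow> 'k ncs" where
  "fps_eval F f = isum (\<lambda>k. scale (fps_nth F k) (f ^ k))"

lemma agree_fps_eval_term: "coeff f [] = 0 \<Longrightarrow> agree k (scale c (f ^ k)) 0"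
  using agree_scale[OF agree_power_zero[of f k], of c] by (simp add: scale_simps)

lemma fps_eval_mult:
  assumes "coeff f [] = 0"
  shows "fps_eval (F * G) f = fps_eval F f * fps_eval G f"
proof -
  have "scale (fps_nth (F * G) k) (f ^ k)
      = (\<Sum>i\<le>k. scale (fps_nth F i) (f ^ i) * scale (fps_nth G (k - i)) (f ^ (k - i)))" for k
  proof -
    have "scale (fps_nth F i) (f ^ i) * scale (fps_nth G (k - i)) (f ^ (k - i))
        = scale (fps_nth F i * fps_nth G (k - i)) (f ^ k)" if "i \<le> k" for i
      using that by (simp add: scale_algebra scale_simps mult.commute flip: power_add)
    then have "(\<Sum>i\<le>k. scale (fps_nth F i) (f ^ i) * scale (fps_nth G (k - i)) (f ^ (k - i)))
        = (\<Sum>i\<le>k. scale (fps_nth F i * fps_nth G (k - i)) (f ^ k))"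
      by (intro sum.cong) auto
    also have "\<dots> = scale (fps_nth (F * G) k) (f ^ k)"
      by (rule ncs_eqI) (simp add: coeff_sum fps_mult_nth sum_distrib_right atMost_atLeast0)
    finally show ?thesis by simp
  qed
  then show ?thesis
    unfolding fps_eval_def using assms by (subst isum_mult_isum) (auto simp: agree_fps_eval_term)
qed

lemma fps_eval_add: "fps_eval (F + G) f = fps_eval F f + fps_eval G f"
  by (simp add: fps_eval_def scale_algebra isum_add)

lemma fps_eval_1 [simp]: "fps_eval 1 f = 1"
proof -
  have "(\<lambda>k. scale (fps_nth 1 k) (f ^ k)) = (\<lambda>k. if k = 0 then 1 else 0)"
    by (auto simp: scale_algebra scale_simps)
  then show ?thesis by (simp add: fps_eval_def isum_single)
qed

lemma fps_eval_X [simp]: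
  assumes "coeff f [] = 0"
  shows "fps_eval fps_X f = f"
proof -
  have "fps_eval fps_X f = isum (\<lambda>k. scale (fps_nth fps_X (Suc k)) (f ^ Suc k))"
    unfolding fps_eval_def by (subst isum_first) (use assms in \<open>simp_all only: agree_fps_eval_term\<close>, simp add: scale_algebra)
  also have "\<dots> = isum (\<lambda>k. if k = 0 then f else 0)"
    by (rule arg_cong[where f = isum]) (auto simp: scale_algebra scale_simps)
  finally show ?thesis by (simp add: isum_single)
qed

lemma fps_eval_power: "coeff f [] = 0 \<Longrightarrow> fps_eval (F ^ k) f = fps_eval F f ^ k"
  by (induction k) (auto simp: fps_eval_mult)

lemma fps_eval_diff_1: "fps_eval (F - 1) f = fps_eval F f - 1"
  using fps_eval_add[of "F - 1" 1 f] by (simp add: eq_diff_eq)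

lemma coeff_fps_eval_Nil [simp]: "coeff (fps_eval F f) [] = fps_nth F 0"
  by (simp add: fps_eval_def coeff_isum)

text \<open>Both sides are double sums over \<open>F\<^sub>i (G\<^sup>i)\<^sub>k f\<^sup>k\<close>, in which \<open>G\<^sup>i\<close> has no terms of degree below \<open>i\<close>.\<close>

lemma fps_eval_compose:
  assumes f: "coeff f [] = 0" and G: "fps_nth G 0 = 0"
  shows "fps_eval (fps_compose F G) f = fps_eval F (fps_eval G f)"
proof (rule ncs_eqI)
  fix w :: "nat list"
  let ?n = "length w"
  have z: "fps_nth (G ^ i) k = 0" if "k < i" for i k
    using that G by (simp add: startsby_zero_power_prefix)
  have "coeff (fps_eval F (fps_eval G f)) w = (\<Sum>i\<le>?n. \<Sum>k\<le>?n. fps_nth F i * fps_nth (G ^ i) k * coeff (f ^ k) w)"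
    unfolding fps_eval_def[of F] coeff_isum coeff_scale fps_eval_power[OF f, symmetric]
    by (simp add: fps_eval_def coeff_isum sum_distrib_left mult.assoc)
  also have "\<dots> = (\<Sum>k\<le>?n. \<Sum>i\<le>?n. fps_nth F i * fps_nth (G ^ i) k * coeff (f ^ k) w)"
    by (rule sum.swap)
  also have "\<dots> = (\<Sum>k\<le>?n. fps_nth (fps_compose F G) k * coeff (f ^ k) w)"
  proof (rule sum.cong)
    fix k assume k: "k \<in> {..?n}"
    have "(\<Sum>i\<le>?n. fps_nth F i * fps_nth (G ^ i) k * coeff (f ^ k) w)
        = (\<Sum>i\<in>{0..k}. fps_nth F i * fps_nth (G ^ i) k * coeff (f ^ k) w)"
      by (rule sum.mono_neutral_right) (use k z in auto)
    then show "(\<Sum>i\<le>?n. fps_nth F i * fps_nth (G ^ i) k * coeff (f ^ k) w)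
        = fps_nth (fps_compose F G) k * coeff (f ^ k) w"
      by (simp add: fps_compose_nth sum_distrib_right)
  qed simp
  finally show "coeff (fps_eval (fps_compose F G) f) w = coeff (fps_eval F (fps_eval G f)) w"
    by (simp add: fps_eval_def coeff_isum)
qed

lemma ncs_exp_fps_eval: "ncs_exp f = fps_eval (fps_exp 1) f"
  by (rule ncs_eqI) (simp add: ncs_exp_def fps_eval_def coeff_isum atMost_atLeast0)

lemma ncs_log_fps_eval: "ncs_log g = fps_eval (fps_ln 1) (g - 1)"
proof (rule ncs_eqI)
  fix w
  have "(\<Sum>k\<le>length w. fps_nth (fps_ln 1) k * coeff ((g - 1) ^ k) w)
      = (\<Sum>k=1..length w. (- 1) ^ (k + 1) * coeff ((g - 1) ^ k) w / of_nat k)"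
  proof (rule sum.mono_neutral_cong_right)
    fix k assume "k \<in> {1..length w}"
    then obtain j where "k = Suc j" by (cases k) auto
    then show "fps_nth (fps_ln 1) k * coeff ((g - 1) ^ k) w
        = (- 1) ^ (k + 1) * coeff ((g - 1) ^ k) w / of_nat k"
      by (simp add: fps_ln_nth)
  qed (auto simp: fps_ln_nth not_less_eq_eq)
  then show "coeff (ncs_log g) w = coeff (fps_eval (fps_ln 1) (g - 1)) w"
    by (simp add: ncs_log_def fps_eval_def coeff_isum)
qed

lemma ncs_exp_isum: "ncs_exp f = isum (\<lambda>k. scale (1 / fact k) (f ^ k))"
  by (simp add: ncs_exp_fps_eval fps_eval_def)

lemma coeff_exp_Nil [simp]: "coeff (ncs_exp f) [] = 1"
  by (simp add: ncs_exp_fps_eval)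

lemma coeff_log_Nil [simp]: "coeff (ncs_log f) [] = 0"
  by (simp add: ncs_log_fps_eval)

lemma fps_exp_ln_inverse:
  "fps_compose (fps_ln 1) (fps_exp 1 - 1) = (fps_X :: 'k::field_char_0 fps)"
  "fps_compose (fps_exp 1 - 1) (fps_ln 1) = (fps_X :: 'k::field_char_0 fps)"
  using fps_inv[of "fps_exp 1 - 1 :: 'k fps"] fps_inv_right[of "fps_exp 1 - 1 :: 'k fps"]
  by (simp_all add: fps_ln_fps_exp_inv)

lemma ncs_log_exp: "coeff f [] = 0 \<Longrightarrow> ncs_log (ncs_exp f) = f"
  using fps_eval_compose[of f "fps_exp 1 - 1" "fps_ln 1"]
  by (simp add: fps_exp_ln_inverse ncs_log_fps_eval ncs_exp_fps_eval fps_eval_diff_1)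

lemma ncs_exp_log: "coeff g [] = 1 \<Longrightarrow> ncs_exp (ncs_log g) = g"
  using fps_eval_compose[of "g - 1" "fps_ln 1" "fps_exp 1 - 1"]
  by (simp add: fps_exp_ln_inverse ncs_log_fps_eval ncs_exp_fps_eval fps_eval_diff_1)

lemma ncs_exp_inj: "coeff f [] = 0 \<Longrightarrow> coeff g [] = 0 \<Longrightarrow> ncs_exp f = ncs_exp g \<Longrightarrow> f = g"
  by (metis ncs_log_exp)

lemma fps_eval_neg: "fps_eval F (- f) = fps_eval (fps_compose F (- fps_X)) f"
proof -
  have "scale (fps_nth F k) ((- f) ^ k) = scale (fps_nth (fps_compose F (- fps_X)) k) (f ^ k)" for k
    using scale_power[of "-1" f k] by (simp add: scale_algebra scale_simps fps_compose_uminus' mult.commute)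
  then show ?thesis by (simp add: fps_eval_def)
qed

lemma ncs_exp_minus:
  assumes "coeff f [] = 0"
  shows "ncs_exp f * ncs_exp (- f) = 1" "ncs_exp (- f) * ncs_exp f = 1"
proof -
  have "fps_compose (fps_exp 1) (- fps_X) = (fps_exp (-1) :: 'a fps)"
    by (rule fps_ext) (simp add: fps_compose_uminus')
  moreover have "fps_exp 1 * fps_exp (-1) = (1 :: 'a fps)"
    using fps_exp_add_mult[of 1 "-1 :: 'a"] by simp
  ultimately show "ncs_exp f * ncs_exp (- f) = 1" "ncs_exp (- f) * ncs_exp f = 1"
    using assms by (simp_all add: ncs_exp_fps_eval fps_eval_neg mult.commute flip: fps_eval_mult)
qed

lemma ncs_exp_0 [simp]: "ncs_exp 0 = 1"
proof -
  have "(\<lambda>k. scale (1 / fact k) (0 ^ k)) = (\<lambda>k. if k = 0 then 1 else (0 :: 'a ncs))"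
    by (auto simp: fun_eq_iff scale_simps power_0_left)
  then show ?thesis by (simp add: ncs_exp_isum isum_single)
qed

text \<open>The exponential turns the Baker-Campbell-Hausdorff product into multiplication, so by
  \<open>ncs_exp_inj\<close> all group laws for \<open>bch\<close> can be checked after exponentiating.\<close>

lemma exp_bch: "ncs_exp (bch f g) = ncs_exp f * ncs_exp g"
  by (simp add: bch_def ncs_exp_log)

lemma coeff_bch_Nil [simp]: "coeff (bch f g) [] = 0"
  by (simp add: bch_def)

lemma bch_0:
  assumes "coeff f [] = 0"
  shows "bch 0 f = f" "bch f 0 = f" "bch f (- f) = 0" "bch (- f) f = 0"
  by (rule ncs_exp_inj; simp add: exp_bch ncs_exp_minus assms)+

lemma bch_assoc: "bch (bch f g) h = bch f (bch g h)"
  by (rule ncs_exp_inj) (simp_all add: exp_bch mult.assoc)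

section \<open>Lie series\<close>

text \<open>A Lie series is one with \<open>lie_approx n d f\<close> for all \<open>d\<close>. The version for a single \<open>d\<close> is what the
  degree-by-degree induction in the Campbell-Baker-Hausdorff theorem needs.\<close>

definition lie_approx :: "nat \<Rightarrow> nat \<Rightarrow> 'k::field_char_0 ncs \<Rightarrow> bool" where
  "lie_approx n d f \<longleftrightarrow> (\<exists>p\<in>free_lie n. agree d f p)"

lemma free_complete_lie_iff: "f \<in> free_complete_lie_set n \<longleftrightarrow> (\<forall>d. lie_approx n d f)"
  by (simp add: free_complete_lie_set_def lie_approx_def agree_def)

lemma coeff_free_lie_Nil [simp]: "f \<in> free_lie n \<Longrightarrow> coeff f [] = 0"
  by (induction f rule: free_lie.induct) auto

lemma free_lie_sum: "(\<And>a. a \<in> A \<Longrightarrow> s a \<in> free_lie n) \<Longrightarrow> sum s A \<in> free_lie n"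
  by (induction A rule: infinite_finite_induct) (auto intro: free_lie.intros)

lemma lie_approx_free_lie: "p \<in> free_lie n \<Longrightarrow> lie_approx n d p"
  unfolding lie_approx_def using agree_refl by blast

lemma lie_approx_0 [simp]: "lie_approx n d 0"
  by (rule lie_approx_free_lie[OF free_lie.zero])

lemma lie_approx_agree: "lie_approx n d g \<Longrightarrow> agree d f g \<Longrightarrow> lie_approx n d f"
  unfolding lie_approx_def using agree_trans by blast

lemma lie_approx_add: "lie_approx n d f \<Longrightarrow> lie_approx n d g \<Longrightarrow> lie_approx n d (f + g)"
  unfolding lie_approx_def using agree_add free_lie.add by meson

lemma lie_approx_scale: "lie_approx n d f \<Longrightarrow> lie_approx n d (scale c f)"
  unfolding lie_approx_def using agree_scale free_lie.scale by meson

lemma lie_approx_minus: "lie_approx n d f \<Longrightarrow> lie_approx n d (- f)"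
  using lie_approx_scale[of n d f "-1"] by (simp add: scale_algebra)

lemma lie_approx_diff: "lie_approx n d f \<Longrightarrow> lie_approx n d g \<Longrightarrow> lie_approx n d (f - g)"
  using lie_approx_add[of n d f "- g"] by (simp add: lie_approx_minus)

lemma lie_approx_bracket:
  "lie_approx n d f \<Longrightarrow> lie_approx n d g \<Longrightarrow> lie_approx n d (ncs_bracket f g)"
  unfolding lie_approx_def using agree_bracket free_lie.bracket by meson

lemma lie_approx_bracket_Suc:
  assumes "lie_approx n d f" "lie_approx n d g" "coeff f [] = 0" "coeff g [] = 0"
  shows "lie_approx n (Suc d) (ncs_bracket f g)"
proof -
  obtain p q where "p \<in> free_lie n" "agree d f p" "q \<in> free_lie n" "agree d g q"
    using assms(1,2) unfolding lie_approx_def by blast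
  then have "agree (Suc d) (ncs_bracket f g) (ncs_bracket p q)" "ncs_bracket p q \<in> free_lie n"
    using assms(3,4) by (auto intro: agree_bracket_Suc free_lie.bracket)
  then show ?thesis unfolding lie_approx_def by blast
qed

lemma lie_approx_sum: "(\<And>a. a \<in> A \<Longrightarrow> lie_approx n d (s a)) \<Longrightarrow> lie_approx n d (sum s A)"
  by (induction A rule: infinite_finite_induct) (auto intro: lie_approx_add)

lemma lie_approx_isum:
  assumes "\<And>k. agree k (s k) 0" "\<And>k. lie_approx n d (s k)"
  shows "lie_approx n d (isum s)"
  using lie_approx_agree[OF lie_approx_sum agree_isum_partial] assms by blast

lemma lie_series_0 [simp]: "0 \<in> free_complete_lie_set n"
  by (simp add: free_complete_lie_iff)

lemma lie_series_var: "i < n \<Longrightarrow> var i \<in> free_complete_lie_set n"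
  by (simp add: free_complete_lie_iff lie_approx_free_lie free_lie.var)

lemma free_lie_lie_series: "p \<in> free_lie n \<Longrightarrow> p \<in> free_complete_lie_set n"
  by (simp add: free_complete_lie_iff lie_approx_free_lie)

lemma lie_series_closed:
  assumes "f \<in> free_complete_lie_set n"
  shows "scale c f \<in> free_complete_lie_set n" "- f \<in> free_complete_lie_set n"
    "g \<in> free_complete_lie_set n \<Longrightarrow> f + g \<in> free_complete_lie_set n"
    "g \<in> free_complete_lie_set n \<Longrightarrow> f - g \<in> free_complete_lie_set n"
    "g \<in> free_complete_lie_set n \<Longrightarrow> ncs_bracket f g \<in> free_complete_lie_set n"
  using assms by (simp_all add: free_complete_lie_iff lie_approx_scale lie_approx_minus
      lie_approx_add lie_approx_diff lie_approx_bracket)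

lemma lie_series_isum:
  "(\<And>k. agree k (s k) 0) \<Longrightarrow> (\<And>k. s k \<in> free_complete_lie_set n) \<Longrightarrow>
    isum s \<in> free_complete_lie_set n"
  by (simp add: free_complete_lie_iff lie_approx_isum)

lemma coeff_lie_series_Nil [simp]: "f \<in> free_complete_lie_set n \<Longrightarrow> coeff f [] = 0"
  unfolding free_complete_lie_iff lie_approx_def
  by (metis agree_1_iff coeff_free_lie_Nil)

section \<open>The Euler derivation\<close>

definition component :: "nat \<Rightarrow> 'k::field_char_0 ncs \<Rightarrow> 'k ncs" where
  "component d f = Abs_ncs (\<lambda>w. if length w = d then coeff f w else 0)"

lemma coeff_component: "coeff (component d f) w = (if length w = d then coeff f w else 0)"
  by (simp add: component_def)

lemma component_mult: "component d (f * g) = (\<Sum>i\<le>d. component i f * component (d - i) g)"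
proof (rule ncs_eqI)
  fix w :: "nat list"
  have t: "(\<Sum>j=0..length w. coeff (component i f) (take j w) * coeff (component (d - i) g) (drop j w))
      = (if length w = d then coeff f (take i w) * coeff g (drop i w) else 0)"
    if "i \<le> d" for i
  proof -
    have "(\<Sum>j=0..length w. coeff (component i f) (take j w) * coeff (component (d - i) g) (drop j w))
        = (\<Sum>j=0..length w. if j = i then
            (if length w = d then coeff f (take i w) * coeff g (drop i w) else 0) else 0)"
      by (rule sum.cong) (use that in \<open>auto simp: coeff_component min_def\<close>)
    then show ?thesis using that by auto
  qed
  show "coeff (component d (f * g)) w = coeff (\<Sum>i\<le>d. component i f * component (d - i) g) w"
    by (simp add: coeff_sum coeff_mult t, simp add: coeff_component coeff_mult atMost_atLeast0)
qed

lemma component_bracket: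
  "component d (ncs_bracket f g) = (\<Sum>i\<le>d. ncs_bracket (component i f) (component (d - i) g))"
proof -
  have "component d (ncs_bracket f g) = component d (f * g) - component d (g * f)"
    by (rule ncs_eqI) (simp add: coeff_component ncs_bracket_def)
  moreover have "component d (g * f) = (\<Sum>i\<le>d. component (d - i) g * component i f)"
    unfolding component_mult by (rule sum.reindex_bij_witness[of _ "\<lambda>i. d - i" "\<lambda>i. d - i"]) auto
  ultimately show ?thesis by (simp add: component_mult ncs_bracket_def sum_subtractf)
qed

text \<open>The relations of the free Lie algebra are homogeneous: components of brackets are sums of brackets of
  components.\<close>

lemma free_lie_component: "f \<in> free_lie n \<Longrightarrow> component d f \<in> free_lie n"
proof (induction f arbitrary: d rule: free_lie.induct)
  case (var i)
  have "component d (var i :: 'a ncs) = (if d = 1 then var i else 0)"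
    by (rule ncs_eqI) (auto simp: coeff_component)
  then show ?case using var by (auto intro: free_lie.intros)
next
  case zero
  have "component d (0 :: 'a ncs) = 0" by (rule ncs_eqI) (simp add: coeff_component)
  then show ?case by (auto intro: free_lie.intros)
next
  case (add f g)
  have "component d (f + g) = component d f + component d g"
    by (rule ncs_eqI) (simp add: coeff_component)
  then show ?case using add by (auto intro: free_lie.intros)
next
  case (scale f c)
  have "component d (scale c f) = scale c (component d f)"
    by (rule ncs_eqI) (simp add: coeff_component)
  then show ?case using scale by (auto intro: free_lie.intros)
next
  case (bracket f g)
  then show ?case by (auto simp: component_bracket intro!: free_lie_sum free_lie.bracket)
qed

text \<open>The derivation that fixes every variable, so that it multiplies a word by its length. It preserves
  Lie series and, in characteristic \<open>0\<close>, a series without constant term can be recovered from it.\<close>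

definition euler :: "'k::field_char_0 ncs \<Rightarrow> 'k ncs" where
  "euler f = Abs_ncs (\<lambda>w. of_nat (length w) * coeff f w)"

lemma coeff_euler [simp]: "coeff (euler f) w = of_nat (length w) * coeff f w"
  by (simp add: euler_def)

lemma euler_linear:
  "euler (f + g) = euler f + euler g" "euler (f - g) = euler f - euler g"
  "euler (scale c f) = scale c (euler f)" "euler 0 = 0" "euler 1 = 0" "euler (var i) = var i"
  by (rule ncs_eqI; simp add: algebra_simps)+

lemma euler_mult: "euler (f * g) = euler f * g + f * euler g"
proof (rule ncs_eqI)
  fix w :: "nat list"
  have "of_nat (length w) * (coeff f (take i w) * coeff g (drop i w))
      = of_nat (length (take i w)) * coeff f (take i w) * coeff g (drop i w)
        + coeff f (take i w) * (of_nat (length (drop i w)) * coeff g (drop i w))"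
    if "i \<in> {0..length w}" for i
    using that by (simp add: of_nat_diff algebra_simps min_def)
  then show "coeff (euler (f * g)) w = coeff (euler f * g + f * euler g) w"
    by (simp add: coeff_mult sum_distrib_left flip: sum.distrib del: length_take length_drop)
qed

lemma euler_bracket: "euler (ncs_bracket f g) = ncs_bracket (euler f) g + ncs_bracket f (euler g)"
  by (simp add: ncs_bracket_def euler_linear euler_mult algebra_simps)

lemma agree_euler: "agree d f g \<Longrightarrow> agree d (euler f) (euler g)"
  by (simp add: agree_def)

lemma free_lie_euler: "f \<in> free_lie n \<Longrightarrow> euler f \<in> free_lie n"
  by (induction f rule: free_lie.induct) (auto simp: euler_linear euler_bracket intro: free_lie.intros)

lemma lie_approx_euler: "lie_approx n d f \<Longrightarrow> lie_approx n d (euler f)"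
  unfolding lie_approx_def using agree_euler free_lie_euler by blast

lemma lie_series_euler: "f \<in> free_complete_lie_set n \<Longrightarrow> euler f \<in> free_complete_lie_set n"
  by (simp add: free_complete_lie_iff lie_approx_euler)

text \<open>Below degree \<open>d\<close>, the inverse of the derivation divides the component of degree \<open>i\<close> by \<open>i\<close>, and
  components of Lie polynomials are Lie polynomials.\<close>

lemma lie_approx_of_euler:
  assumes "lie_approx n d (euler f)" "coeff f [] = 0"
  shows "lie_approx n d f"
proof -
  obtain p where p: "p \<in> free_lie n" "agree d (euler f) p"
    using assms(1) unfolding lie_approx_def by blast
  let ?q = "\<Sum>i<d. scale (1 / of_nat i) (component i p)"
  have "coeff ?q w = coeff f w" if w: "length w < d" for w
  proof -
    have "coeff ?q w = (\<Sum>i<d. if i = length w then coeff p w / of_nat (length w) else 0)"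
      unfolding coeff_sum by (rule sum.cong) (auto simp: coeff_component)
    also have "\<dots> = of_nat (length w) * coeff f w / of_nat (length w)"
      using w p(2) by (simp add: agree_def)
    finally show ?thesis using assms(2) by (cases "w = []") auto
  qed
  moreover have "?q \<in> free_lie n"
    by (intro free_lie_sum free_lie.scale free_lie_component p)
  ultimately show ?thesis unfolding lie_approx_def agree_def by metis
qed

section \<open>The Campbell-Baker-Hausdorff theorem\<close>

abbreviation ad :: "'k::field_char_0 ncs \<Rightarrow> nat \<Rightarrow> 'k ncs \<Rightarrow> 'k ncs" where
  "ad z k \<equiv> ncs_bracket z ^^ k"

lemma agree_ad_zero: "coeff z [] = 0 \<Longrightarrow> agree k (ad z k x) 0"
proof (induction k)
  case (Suc k)
  then have "agree (Suc k) (z * ad z k x - ad z k x * z) (0 - 0)"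
    using agree_mult_zero[of 1 z k "ad z k x"] agree_mult_zero[of k "ad z k x" 1 z]
    by (intro agree_diff) (simp_all add: agree_1_iff)
  then show ?case by (simp add: ncs_bracket_def[of z "ad z k x"])
qed simp

lemma agree_scale_ad: "coeff z [] = 0 \<Longrightarrow> agree k (scale c (ad z k x)) 0"
  using agree_scale[OF agree_ad_zero[of z k x], of c] by (simp add: scale_simps)

text \<open>\<open>e\<^sup>a\<^sup>d \<^sup>z x\<close>, which is the conjugate of \<open>x\<close> by \<open>e\<^sup>z\<close> by \<open>exp_conj\<close> below.\<close>

definition Ad_exp :: "'k::field_char_0 ncs \<Rightarrow> 'k ncs \<Rightarrow> 'k ncs" where
  "Ad_exp z x = isum (\<lambda>k. scale (1 / fact k) (ad z k x))"

text \<open>\<open>\<Phi> (ad z) x\<close> for \<open>\<Phi> t = (e\<^sup>t - 1) / t\<close>. It governs the derivative of the exponential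
  (\<open>euler_exp\<close>), and it factors the bracket \<open>[z, y]\<close> out of a conjugate: \<open>e\<^sup>a\<^sup>d \<^sup>z y - y = \<Phi> (ad z) [z, y]\<close>.\<close>

definition dexp :: "'k::field_char_0 ncs \<Rightarrow> 'k ncs \<Rightarrow> 'k ncs" where
  "dexp z x = isum (\<lambda>k. scale (1 / fact (Suc k)) (ad z k x))"

text \<open>Left multiplication by \<open>z\<close> is the sum of the commuting operators \<open>ad z\<close> and right multiplication by
  \<open>z\<close>; this is the binomial theorem for them.\<close>

lemma power_mult_ad:
  "z ^ k * x = (\<Sum>i\<le>k. scale (of_nat (k choose i)) (ad z i x * z ^ (k - i)))"
proof (induction k)
  case 0
  then show ?case by (simp add: scale_simps)
next
  case (Suc k)
  let ?t = "\<lambda>k i. ad z i x * z ^ (k - i)"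
  have "z * (ad z i x * z ^ (k - i)) = ?t (Suc k) (Suc i) + ?t (Suc k) i" if "i \<le> k" for i
    using that by (simp add: ncs_bracket_def algebra_simps Suc_diff_le power_Suc2 del: power_Suc flip: power_Suc2)
      (simp add: power_commutes)
  then have "z ^ Suc k * x = (\<Sum>i\<le>k. scale (of_nat (k choose i)) (?t (Suc k) (Suc i) + ?t (Suc k) i))"
    by (simp add: mult.assoc Suc sum_distrib_left scale_algebra)
  also have "\<dots> = (\<Sum>i\<le>k. scale (of_nat (k choose i)) (?t (Suc k) (Suc i)))
      + (\<Sum>i\<le>Suc k. scale (of_nat (k choose i)) (?t (Suc k) i))"
    by (simp add: scale_simps sum.distrib scale_algebra binomial_eq_0)
  also have "\<dots> = (\<Sum>i\<le>Suc k. scale (of_nat (Suc k choose i)) (?t (Suc k) i))"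
    unfolding sum.atMost_Suc_shift by (simp add: scale_algebra sum.distrib algebra_simps)
  finally show ?case .
qed

text \<open>By the Leibniz rule \<open>D (z\<^sup>k\<^sup>+\<^sup>1) = D (z\<^sup>k) z + z\<^sup>k D z\<close>; expanding the last term with
  \<open>power_mult_ad\<close>, the coefficients add up by Pascal's rule.\<close>

lemma euler_power:
  "euler (z ^ Suc k) = (\<Sum>i\<le>k. scale (of_nat (Suc k choose Suc i)) (ad z i (euler z) * z ^ (k - i)))"
proof (induction k)
  case 0
  then show ?case by (simp add: scale_simps)
next
  case (Suc k)
  let ?t = "\<lambda>k i. ad z i (euler z) * z ^ (k - i)"
  have "?t k i * z = ?t (Suc k) i" if "i \<le> k" for i
    using that by (simp add: mult.assoc Suc_diff_le power_Suc2 del: power_Suc)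
  then have "euler (z ^ Suc k) * z
      = (\<Sum>i\<le>k. scale (of_nat (Suc k choose Suc i)) (?t (Suc k) i))"
    unfolding Suc sum_distrib_right by (intro sum.cong) (auto simp: scale_algebra simp del: binomial_Suc_Suc)
  also have "\<dots> = (\<Sum>i\<le>Suc k. scale (of_nat (Suc k choose Suc i)) (?t (Suc k) i))"
    by (simp add: scale_algebra binomial_eq_0)
  finally have "euler (z ^ Suc (Suc k)) = \<dots> + z ^ Suc k * euler z"
    by (subst power_Suc2, subst euler_mult) simp
  also have "\<dots> = (\<Sum>i\<le>Suc k. scale (of_nat (Suc (Suc k) choose Suc i)) (?t (Suc k) i))"
    unfolding power_mult_ad[of z "Suc k" "euler z"] sum.distrib[symmetric]
    by (rule sum.cong) (simp_all only: binomial_Suc_Suc of_nat_add scale_algebra add_ac)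
  finally show ?case .
qed

lemma exp_mult_Ad:
  assumes z: "coeff z [] = 0"
  shows "ncs_exp z * x = Ad_exp z x * ncs_exp z"
proof -
  have "ncs_exp z * x = isum (\<lambda>k. scale (1 / fact k) (z ^ k) * x)"
    unfolding ncs_exp_isum by (rule isum_mult_right) (simp add: agree_fps_eval_term z)
  also have "(\<lambda>k. scale (1 / fact k) (z ^ k) * x) = (\<lambda>k. \<Sum>i\<le>k. scale (1 / fact i) (ad z i x)
      * scale (1 / fact (k - i)) (z ^ (k - i)))"
    by (auto simp: fun_eq_iff scale_algebra scale_simps power_mult_ad binomial_fact mult.commute intro!: sum.cong)
  also have "isum \<dots> = Ad_exp z x * ncs_exp z"
    unfolding ncs_exp_isum Ad_exp_def
    by (rule isum_mult_isum[symmetric]) (simp_all add: agree_fps_eval_term agree_scale_ad z)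
  finally show ?thesis .
qed

lemma exp_conj: "coeff z [] = 0 \<Longrightarrow> ncs_exp z * x * ncs_exp (- z) = Ad_exp z x"
  by (simp only: exp_mult_Ad[of z x] mult.assoc[of "Ad_exp z x"] ncs_exp_minus mult_1_right)

text \<open>After division by \<open>(k + 1)!\<close>, \<open>euler_power\<close> becomes the general term of the Cauchy product of
  \<open>dexp z (euler z)\<close> and \<open>e\<^sup>z\<close>. The shift by one in the exponent is harmless since \<open>D 1 = 0\<close>.\<close>

lemma euler_exp:
  assumes z: "coeff z [] = 0"
  shows "euler (ncs_exp z) = dexp z (euler z) * ncs_exp z"
proof -
  have ord: "agree k (scale (1 / fact k) (euler (z ^ k))) 0" for k
    using agree_euler[OF agree_fps_eval_term[OF z, of k "1 / fact k"]] by (simp add: euler_linear)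
  have "euler (ncs_exp z) = isum (\<lambda>k. euler (scale (1 / fact k) (z ^ k)))"
    unfolding ncs_exp_isum
    by (rule isum_additive) (use ord in \<open>simp_all add: agree_fps_eval_term z agree_euler euler_linear\<close>)
  also have "\<dots> = isum (\<lambda>k. scale (1 / fact k) (euler (z ^ k)))"
    by (simp add: euler_linear)
  also have "\<dots> = isum (\<lambda>k. scale (1 / fact (Suc k)) (euler (z ^ Suc k)))"
    by (subst isum_first[OF ord]) (simp add: euler_linear scale_simps)
  also have "(\<lambda>k. scale (1 / fact (Suc k)) (euler (z ^ Suc k)))
      = (\<lambda>k. \<Sum>i\<le>k. scale (1 / fact (Suc i)) (ad z i (euler z)) * scale (1 / fact (k - i)) (z ^ (k - i)))"
    unfolding euler_power
    by (auto simp: fun_eq_iff scale_algebra scale_simps binomial_fact mult.commute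
        simp del: fact_Suc binomial_Suc_Suc intro!: sum.cong)
  also have "isum \<dots> = dexp z (euler z) * ncs_exp z"
    unfolding ncs_exp_isum dexp_def
    by (rule isum_mult_isum[symmetric]) (simp_all add: agree_fps_eval_term agree_scale_ad z del: fact_Suc)
  finally show ?thesis .
qed

lemma lie_series_ad:
  "z \<in> free_complete_lie_set n \<Longrightarrow> x \<in> free_complete_lie_set n \<Longrightarrow> ad z k x \<in> free_complete_lie_set n"
  by (induction k) (auto intro: lie_series_closed)

lemma lie_series_Ad_exp:
  "z \<in> free_complete_lie_set n \<Longrightarrow> x \<in> free_complete_lie_set n \<Longrightarrow> Ad_exp z x \<in> free_complete_lie_set n"
  unfolding Ad_exp_def
  by (rule lie_series_isum) (auto intro: lie_series_ad lie_series_closed agree_scale_ad)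

lemma lie_series_dexp:
  "z \<in> free_complete_lie_set n \<Longrightarrow> x \<in> free_complete_lie_set n \<Longrightarrow> dexp z x \<in> free_complete_lie_set n"
  unfolding dexp_def
  by (rule lie_series_isum) (auto intro: lie_series_ad lie_series_closed agree_scale_ad simp del: fact_Suc)

text \<open>Let \<open>z = log (e\<^sup>x e\<^sup>y)\<close> and let \<open>D\<close> be the Euler derivation. Applying \<open>D\<close> to \<open>e\<^sup>z = e\<^sup>x e\<^sup>y\<close> and cancelling
  \<open>e\<^sup>z\<close> shows that \<open>\<Phi> (ad z) (D z)\<close> is the Lie series \<open>u\<close> below. Since \<open>\<Phi>\<close> starts with \<open>1\<close>, \<open>D z\<close> is \<open>u\<close>
  minus terms containing at least one bracket with \<open>z\<close>. If \<open>z\<close> is a Lie series below degree \<open>d\<close>, those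
  terms are so below degree \<open>d + 1\<close>, hence so are \<open>D z\<close> and \<open>z\<close>.\<close>

theorem campbell_baker_hausdorff:
  assumes x: "x \<in> free_complete_lie_set n" and y: "y \<in> free_complete_lie_set n"
  shows "bch x y \<in> free_complete_lie_set n"
proof -
  define z where "z = bch x y"
  define u where "u = dexp x (euler x) + Ad_exp x (dexp y (euler y))"
  have z0: "coeff z [] = 0" by (simp add: z_def)
  have u: "u \<in> free_complete_lie_set n"
    unfolding u_def by (intro lie_series_closed lie_series_dexp lie_series_Ad_exp lie_series_euler x y)
  have "dexp z (euler z) * ncs_exp z = euler (ncs_exp x * ncs_exp y)"
    using euler_exp[OF z0] by (simp add: z_def exp_bch)
  also have "\<dots> = dexp x (euler x) * ncs_exp x * ncs_exp y
      + ncs_exp x * dexp y (euler y) * ncs_exp y"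
    using x y by (simp add: euler_mult euler_exp mult.assoc)
  also have "\<dots> = u * ncs_exp z"
    using x by (simp add: exp_mult_Ad[of x "dexp y (euler y)"] u_def z_def exp_bch algebra_simps)
  finally have "dexp z (euler z) * ncs_exp z * ncs_exp (- z) = u * ncs_exp z * ncs_exp (- z)"
    by simp
  then have "u = dexp z (euler z)" by (simp add: mult.assoc ncs_exp_minus z0)
  also have "\<dots> = euler z + isum (\<lambda>k. scale (1 / fact (Suc (Suc k))) (ad z (Suc k) (euler z)))"
    unfolding dexp_def
    by (subst isum_first) (simp_all add: agree_scale_ad z0 scale_simps del: fact_Suc funpow.simps(2))
  finally have eq: "euler z = u - isum (\<lambda>k. scale (1 / fact (Suc (Suc k))) (ad z (Suc k) (euler z)))"
    by (simp add: algebra_simps)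
  have "lie_approx n d z" for d
  proof (induction d)
    case 0
    show ?case using free_lie.zero by (auto simp: lie_approx_def)
  next
    case (Suc d)
    have "lie_approx n d (ad z k (euler z))" for k
      by (induction k) (auto intro: lie_approx_euler lie_approx_bracket Suc)
    moreover have "coeff (ad z k (euler z)) [] = 0" for k
      by (cases k) auto
    ultimately have "lie_approx n (Suc d) (ad z (Suc k) (euler z))" for k
      using Suc z0 by (auto intro: lie_approx_bracket_Suc)
    moreover have "agree k (ad z (Suc k) (euler z)) 0" for k
      using agree_mono[OF agree_ad_zero[OF z0], of k "Suc k"] by simp
    ultimately have "lie_approx n (Suc d) (isum (\<lambda>k. scale (1 / fact (Suc (Suc k))) (ad z (Suc k) (euler z))))"
      by (intro lie_approx_isum lie_approx_scale agree_scale_zero)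
    then have "lie_approx n (Suc d) (euler z)"
      using u by (subst eq) (auto simp: free_complete_lie_iff intro: lie_approx_diff)
    then show ?case by (rule lie_approx_of_euler[OF _ z0])
  qed
  then show ?thesis by (simp add: free_complete_lie_iff z_def)
qed

section \<open>Substitution\<close>

definition words :: "nat \<Rightarrow> nat \<Rightarrow> nat list set" where
  "words n k = {u. set u \<subseteq> {..<n} \<and> length u = k}"

lemma finite_words [simp]: "finite (words n k)"
  unfolding words_def by (rule finite_lists_length_eq) simp

lemma words_0 [simp]: "words n 0 = {[]}"
  by (auto simp: words_def)

text \<open>For \<open>g i\<close> without constant term this is the continuous algebra homomorphism that sends \<open>x\<^sub>i\<close> to \<open>g i\<close>
  for \<open>i < n\<close> and the other variables to \<open>0\<close>; restricting to finitely many variables makes each inner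
  sum finite.\<close>

definition substitute :: "nat \<Rightarrow> (nat \<Rightarrow> 'k::field_char_0 ncs) \<Rightarrow> 'k ncs \<Rightarrow> 'k ncs" where
  "substitute n g f = isum (\<lambda>k. \<Sum>u\<in>words n k. scale (coeff f u) (prod_list (map g u)))"

lemma agree_prod_list_zero:
  "(\<And>i. i \<in> set u \<Longrightarrow> coeff (g i) [] = 0) \<Longrightarrow> agree (length u) (prod_list (map g u)) 0"
proof (induction u)
  case (Cons i u)
  then show ?case using agree_mult_zero[of 1 "g i" "length u" "prod_list (map g u)"]
    by (simp add: agree_1_iff)
qed simp

lemma substitute_linear:
  "substitute n g (f + h) = substitute n g f + substitute n g h"
  "substitute n g (scale c f) = scale c (substitute n g f)"
  "substitute n g (f - h) = substitute n g f - substitute n g h"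
proof -
  show add: "substitute n g (f + h) = substitute n g f + substitute n g h" for f h
    by (simp add: substitute_def scale_algebra sum.distrib flip: isum_add)
  show sc: "substitute n g (scale c f) = scale c (substitute n g f)" for c f
    by (simp add: substitute_def scale_algebra flip: isum_scale) (simp add: scale_simps)
  show "substitute n g (f - h) = substitute n g f - substitute n g h"
    using add[of f "scale (-1) h"] sc[of "-1" h] by (simp add: scale_algebra)
qed

lemma substitute_0 [simp]: "substitute n g 0 = 0"
  using substitute_linear(3)[of n g 0 0] by simp

lemma coeff_substitute_Nil [simp]: "coeff (substitute n g f) [] = coeff f []"
  by (simp add: substitute_def coeff_isum coeff_sum)

locale substitution =
  fixes n :: nat and g :: "nat \<Rightarrow> 'k::field_char_0 ncs"
  assumes coeff_g: "i < n \<Longrightarrow> coeff (g i) [] = 0"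
begin

lemma agree_substitute_term:
  "agree k (\<Sum>u\<in>words n k. scale (c u) (prod_list (map g u))) 0"
proof (intro agree_sum_zero agree_scale_zero)
  fix u assume "u \<in> words n k"
  then show "agree k (prod_list (map g u)) 0"
    using agree_prod_list_zero[of u g] coeff_g by (auto simp: words_def)
qed

lemma agree_substitute:
  assumes "agree d f h"
  shows "agree d (substitute n g f) (substitute n g h)"
  unfolding substitute_def
proof (rule agree_isum_cong)
  fix k
  show "agree d (\<Sum>u\<in>words n k. scale (coeff f u) (prod_list (map g u)))
      (\<Sum>u\<in>words n k. scale (coeff h u) (prod_list (map g u)))"
  proof (cases "k < d")
    case True
    then have "coeff f u = coeff h u" if "u \<in> words n k" for u
      using assms that by (auto simp: agree_def words_def)
    then show ?thesis by (intro agree_sum) simp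
  next
    case False
    then show ?thesis
      using agree_mono[OF agree_substitute_term, of d k] agree_sym agree_trans by (meson leI)
  qed
qed

lemma substitute_mult: "substitute n g (f * h) = substitute n g f * substitute n g h"
proof -
  let ?G = "\<lambda>u. prod_list (map g u)"
  have "(\<Sum>u\<in>words n k. scale (coeff (f * h) u) (?G u))
      = (\<Sum>i\<le>k. (\<Sum>u\<in>words n i. scale (coeff f u) (?G u))
          * (\<Sum>v\<in>words n (k - i). scale (coeff h v) (?G v)))" for k
  proof -
    have "(\<Sum>u\<in>words n i. scale (coeff f u) (?G u)) * (\<Sum>v\<in>words n (k - i). scale (coeff h v) (?G v))
        = (\<Sum>w\<in>words n k. scale (coeff f (take i w) * coeff h (drop i w)) (?G w))"
      if "i \<le> k" for i
    proof -
      have "(\<Sum>u\<in>words n i. scale (coeff f u) (?G u)) * (\<Sum>v\<in>words n (k - i). scale (coeff h v) (?G v))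
          = (\<Sum>(u, v)\<in>words n i \<times> words n (k - i). scale (coeff f u * coeff h v) (?G (u @ v)))"
        by (simp add: sum_product sum.cartesian_product scale_algebra scale_simps mult.commute)
      also have "\<dots> = (\<Sum>w\<in>words n k. scale (coeff f (take i w) * coeff h (drop i w)) (?G w))"
        by (rule sum.reindex_bij_witness[of _ "\<lambda>w. (take i w, drop i w)" "\<lambda>(u, v). u @ v"])
          (use that in \<open>auto simp: words_def dest: in_set_takeD in_set_dropD\<close>)
      finally show ?thesis .
    qed
    then have "(\<Sum>i\<le>k. (\<Sum>u\<in>words n i. scale (coeff f u) (?G u))
          * (\<Sum>v\<in>words n (k - i). scale (coeff h v) (?G v)))
        = (\<Sum>i\<le>k. \<Sum>w\<in>words n k. scale (coeff f (take i w) * coeff h (drop i w)) (?G w))"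
      by (intro sum.cong) auto
    also have "\<dots> = (\<Sum>w\<in>words n k. \<Sum>i\<le>k. scale (coeff f (take i w) * coeff h (drop i w)) (?G w))"
      by (rule sum.swap)
    also have "\<dots> = (\<Sum>w\<in>words n k. scale (coeff (f * h) w) (?G w))"
    proof (rule sum.cong)
      fix w assume "w \<in> words n k"
      then show "(\<Sum>i\<le>k. scale (coeff f (take i w) * coeff h (drop i w)) (?G w))
          = scale (coeff (f * h) w) (?G w)"
        by (intro ncs_eqI) (auto simp: coeff_sum coeff_mult words_def sum_distrib_right atMost_atLeast0)
    qed simp
    finally show ?thesis by simp
  qed
  then show ?thesis
    unfolding substitute_def by (subst isum_mult_isum) (auto simp: agree_substitute_term)
qed

lemma substitute_1 [simp]: "substitute n g 1 = 1"
proof -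
  have "(\<lambda>k. \<Sum>u\<in>words n k. scale (coeff 1 u) (prod_list (map g u))) = (\<lambda>k. if k = 0 then 1 else 0)"
  proof
    fix k
    have "scale (coeff 1 u) (prod_list (map g u)) = 0" if "u \<in> words n k" "k > 0" for u
      using that by (auto simp: words_def scale_algebra)
    then show "(\<Sum>u\<in>words n k. scale (coeff 1 u) (prod_list (map g u))) = (if k = 0 then 1 else 0)"
      by (cases "k = 0") (auto simp: scale_simps)
  qed
  then show ?thesis by (simp add: substitute_def isum_single)
qed

lemma substitute_var [simp]:
  assumes "i < n"
  shows "substitute n g (var i) = g i"
proof -
  have *: "(\<Sum>u\<in>words n k. scale (coeff (var i) u) (prod_list (map g u))) = (if k = 1 then g i else 0)" for k
  proof -
    have "(\<Sum>u\<in>words n k. scale (coeff (var i) u) (prod_list (map g u)))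
        = (\<Sum>u\<in>words n k. if u = [i] then g i else 0)"
      by (rule sum.cong) (auto simp: scale_simps scale_algebra)
    also have "\<dots> = (if [i] \<in> words n k then g i else 0)" by simp
    finally show ?thesis using assms by (auto simp: words_def)
  qed
  have "substitute n g (var i) = isum (\<lambda>k. if k = 1 then g i else 0)"
    unfolding substitute_def * ..
  also have "\<dots> = isum (\<lambda>k. if k = 0 then g i else 0)"
    by (subst isum_first) (use coeff_g[OF assms] in \<open>auto simp: agree_1_iff\<close>)
  finally show ?thesis by (simp add: isum_single)
qed

lemma substitute_power: "substitute n g (f ^ k) = substitute n g f ^ k"
  by (induction k) (auto simp: substitute_mult)

lemma substitute_bracket: "substitute n g (ncs_bracket f h) = ncs_bracket (substitute n g f) (substitute n g h)"
  by (simp add: ncs_bracket_def substitute_linear substitute_mult)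

lemma substitute_exp:
  assumes f: "coeff f [] = 0"
  shows "substitute n g (ncs_exp f) = ncs_exp (substitute n g f)"
proof -
  have "agree k (scale (1 / fact k) (f ^ k)) 0" for k
    using agree_fps_eval_term[OF f] .
  moreover from this have "agree k (substitute n g (scale (1 / fact k) (f ^ k))) 0" for k
    using agree_substitute[of k _ 0] by simp
  ultimately show ?thesis
    unfolding ncs_exp_isum
    by (subst isum_additive[where F = "substitute n g"]) (auto simp: agree_substitute substitute_linear substitute_power)
qed

lemma substitute_bch:
  "coeff x [] = 0 \<Longrightarrow> coeff y [] = 0 \<Longrightarrow> substitute n g (bch x y) = bch (substitute n g x) (substitute n g y)"
  by (rule ncs_exp_inj) (simp_all only: exp_bch substitute_exp[symmetric] substitute_mult coeff_bch_Nil coeff_substitute_Nil)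

end

lemma agree_lie_series:
  assumes "f \<in> free_complete_lie_set n"
  obtains p where "p \<in> free_lie n" "agree d f p"
  using assms by (auto simp: free_complete_lie_iff lie_approx_def)

section \<open>Closed ideals\<close>

text \<open>Congruence modulo the ideal is written as \<open>x - y \<in> I\<close> throughout, which avoids computing with cosets
  until the quotients themselves have to be compared.\<close>

locale closed_lie_ideal =
  fixes n :: nat and I :: "'k::field_char_0 ncs set"
  assumes ideal: "lie_ideal (free_complete_lie n) I"
    and closed: "filt_closed (free_complete_lie n) I"
begin

lemma subset: "x \<in> I \<Longrightarrow> x \<in> free_complete_lie_set n"
  using ideal by (auto simp: lie_ideal_def free_complete_lie_def)

lemma zero_mem: "0 \<in> I"
  using ideal by (auto simp: lie_ideal_def free_complete_lie_def)

lemma add_mem: "x \<in> I \<Longrightarrow> y \<in> I \<Longrightarrow> x + y \<in> I"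
  using ideal by (auto simp: lie_ideal_def free_complete_lie_def)

lemma scale_mem: "x \<in> I \<Longrightarrow> scale c x \<in> I"
  using ideal by (auto simp: lie_ideal_def free_complete_lie_def)

lemma minus_mem: "x \<in> I \<Longrightarrow> - x \<in> I"
  using scale_mem[of x "-1"] by (simp add: scale_algebra)

lemma diff_mem: "x \<in> I \<Longrightarrow> y \<in> I \<Longrightarrow> x - y \<in> I"
  using add_mem[of x "- y"] minus_mem by simp

lemma sum_mem: "(\<And>a. a \<in> A \<Longrightarrow> s a \<in> I) \<Longrightarrow> sum s A \<in> I"
  by (induction A rule: infinite_finite_induct) (auto intro: zero_mem add_mem)

lemma bracket_right: "x \<in> free_complete_lie_set n \<Longrightarrow> y \<in> I \<Longrightarrow> ncs_bracket x y \<in> I"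
  using ideal by (auto simp: lie_ideal_def free_complete_lie_def)

lemma bracket_left: "x \<in> I \<Longrightarrow> y \<in> free_complete_lie_set n \<Longrightarrow> ncs_bracket x y \<in> I"
  using bracket_right[of y x, THEN minus_mem] by (simp add: ncs_bracket_def)

lemma limit:
  assumes "x \<in> free_complete_lie_set n" and "\<And>d. \<exists>y\<in>I. agree d x y"
  shows "x \<in> I"
proof -
  have "\<exists>y\<in>I. \<exists>z\<in>lfilt (free_complete_lie n) d. x = ladd (free_complete_lie n) y z" for d
  proof -
    obtain y where y: "y \<in> I" "agree d x y" using assms(2) by blast
    then have "x - y \<in> lfilt (free_complete_lie n) d"
      using assms(1) subset by (auto simp: free_complete_lie_def agree_def intro: lie_series_closed)
    moreover have "x = ladd (free_complete_lie n) y (x - y)" by (simp add: free_complete_lie_def)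
    ultimately show ?thesis using y(1) by blast
  qed
  then show ?thesis
    using closed assms(1) by (auto simp: filt_closed_def free_complete_lie_def)
qed

lemma isum_mem:
  assumes "\<And>k. agree k (s k) 0" "\<And>k. s k \<in> I"
  shows "isum s \<in> I"
proof (rule limit)
  show "isum s \<in> free_complete_lie_set n" using assms subset lie_series_isum by blast
  show "\<exists>y\<in>I. agree d (isum s) y" for d
    using agree_isum_partial[of s d d] assms sum_mem[of "{..<d}" s] by blast
qed

lemma cong_bracket:
  assumes "x - x' \<in> I" "y - y' \<in> I" "x' \<in> free_complete_lie_set n" "y \<in> free_complete_lie_set n"
  shows "ncs_bracket x y - ncs_bracket x' y' \<in> I"
proof -
  have "ncs_bracket x y - ncs_bracket x' y' = ncs_bracket (x - x') y + ncs_bracket x' (y - y')"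
    by (simp add: ncs_bracket_def algebra_simps)
  then show ?thesis using assms by (auto intro: add_mem bracket_left bracket_right)
qed

lemma cong_sym: "x - y \<in> I \<Longrightarrow> y - x \<in> I"
  using minus_mem[of "x - y"] by simp

lemma cong_trans: "x - y \<in> I \<Longrightarrow> y - z \<in> I \<Longrightarrow> x - z \<in> I"
  using add_mem[of "x - y" "y - z"] by simp

end

section \<open>Continuous Lie homomorphisms\<close>

locale cont_lie_hom =
  fixes n m :: nat and \<theta> :: "'k::field_char_0 ncs \<Rightarrow> 'k ncs"
  assumes mem: "f \<in> free_complete_lie_set n \<Longrightarrow> \<theta> f \<in> free_complete_lie_set m"
    and add: "f \<in> free_complete_lie_set n \<Longrightarrow> h \<in> free_complete_lie_set n \<Longrightarrow> \<theta> (f + h) = \<theta> f + \<theta> h"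
    and scale: "f \<in> free_complete_lie_set n \<Longrightarrow> \<theta> (scale c f) = scale c (\<theta> f)"
    and bracket: "f \<in> free_complete_lie_set n \<Longrightarrow> h \<in> free_complete_lie_set n \<Longrightarrow>
      \<theta> (ncs_bracket f h) = ncs_bracket (\<theta> f) (\<theta> h)"
    and agree: "f \<in> free_complete_lie_set n \<Longrightarrow> h \<in> free_complete_lie_set n \<Longrightarrow> agree d f h \<Longrightarrow>
      agree d (\<theta> f) (\<theta> h)"
begin

lemma zero: "\<theta> 0 = 0"
  using scale[of 0 0] by (simp add: scale_algebra)

lemma diff: "f \<in> free_complete_lie_set n \<Longrightarrow> h \<in> free_complete_lie_set n \<Longrightarrow> \<theta> (f - h) = \<theta> f - \<theta> h"
  using add[of f "scale (-1) h"] scale[of h "-1"] by (simp add: scale_algebra lie_series_closed)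

end

lemma cont_lie_hom_id: "cont_lie_hom n n (\<lambda>f. f)"
  by unfold_locales auto

lemma cont_lie_hom_comp:
  assumes "cont_lie_hom n m \<theta>" "cont_lie_hom m l \<eta>"
  shows "cont_lie_hom n l (\<lambda>f. \<eta> (\<theta> f))"
proof -
  interpret \<theta>: cont_lie_hom n m \<theta> by fact
  interpret \<eta>: cont_lie_hom m l \<eta> by fact
  show ?thesis
    by unfold_locales
      (auto simp: \<theta>.mem \<eta>.mem \<theta>.add \<eta>.add \<theta>.scale \<eta>.scale \<theta>.bracket \<eta>.bracket
        intro: \<theta>.agree \<eta>.agree)
qed

lemma cont_lie_hom_substitute:
  fixes g :: "nat \<Rightarrow> 'k::field_char_0 ncs"
  assumes g: "\<And>i. i < n \<Longrightarrow> g i \<in> free_complete_lie_set m"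
  shows "cont_lie_hom n m (substitute n g)"
proof -
  interpret substitution n g using g by unfold_locales (auto intro: coeff_lie_series_Nil)
  have poly: "substitute n g p \<in> free_complete_lie_set m" if "p \<in> free_lie n" for p
    using that by (induction p rule: free_lie.induct)
      (auto simp: g substitute_linear substitute_bracket intro: lie_series_closed)
  have "substitute n g f \<in> free_complete_lie_set m" if "f \<in> free_complete_lie_set n" for f
    unfolding free_complete_lie_iff
  proof
    fix d
    obtain p where "p \<in> free_lie n" "agree d f p" using agree_lie_series[OF \<open>f \<in> _\<close>] .
    then show "lie_approx m d (substitute n g f)"
      using poly[of p] agree_substitute lie_approx_agree unfolding free_complete_lie_iff by blast
  qed
  then show ?thesis
    by unfold_locales (auto simp: substitute_linear substitute_bracket agree_substitute)
qed

context closed_lie_ideal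
begin

text \<open>Lie polynomials are built from the variables, and Lie series are limits of Lie polynomials. This
  single fact yields both that \<open>bch\<close> descends to the quotient and that the maps between two
  presentations are mutually inverse.\<close>

lemma cont_lie_hom_cong:
  assumes \<theta>: "cont_lie_hom m n \<theta>" and \<eta>: "cont_lie_hom m n \<eta>"
    and var: "\<And>i. i < m \<Longrightarrow> \<theta> (var i) - \<eta> (var i) \<in> I"
    and f: "f \<in> free_complete_lie_set m"
  shows "\<theta> f - \<eta> f \<in> I"
proof -
  interpret \<theta>: cont_lie_hom m n \<theta> by fact
  interpret \<eta>: cont_lie_hom m n \<eta> by fact
  have poly: "\<theta> p - \<eta> p \<in> I" if "p \<in> free_lie m" for p
    using that
  proof (induction p rule: free_lie.induct)
    case zero
    show ?case by (simp add: \<theta>.zero \<eta>.zero zero_mem)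
  next
    case (add p q)
    then have "\<theta> (p + q) - \<eta> (p + q) = (\<theta> p - \<eta> p) + (\<theta> q - \<eta> q)"
      by (simp add: \<theta>.add \<eta>.add free_lie_lie_series)
    then show ?case using add.IH add_mem by simp
  next
    case (scale p c)
    then have "\<theta> (scale c p) - \<eta> (scale c p) = scale c (\<theta> p - \<eta> p)"
      by (simp add: \<theta>.scale \<eta>.scale free_lie_lie_series scale_algebra)
    then show ?case using scale.IH scale_mem by simp
  next
    case (bracket p q)
    then show ?case
      by (simp add: \<theta>.bracket \<eta>.bracket \<theta>.mem \<eta>.mem free_lie_lie_series cong_bracket)
  qed (rule var)
  show ?thesis
  proof (rule limit)
    show "\<theta> f - \<eta> f \<in> free_complete_lie_set n"
      by (intro lie_series_closed \<theta>.mem \<eta>.mem f)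
    fix d
    obtain p where p: "p \<in> free_lie m" "agree d f p" using agree_lie_series[OF f] .
    then have "agree d (\<theta> f - \<eta> f) (\<theta> p - \<eta> p)"
      by (intro agree_diff \<theta>.agree \<eta>.agree f free_lie_lie_series)
    then show "\<exists>y\<in>I. agree d (\<theta> f - \<eta> f) y" using poly[OF p(1)] by blast
  qed
qed

end

section \<open>The group law modulo a closed ideal\<close>

definition pair :: "'a \<Rightarrow> 'a \<Rightarrow> nat \<Rightarrow> 'a" where
  "pair x y i = (if i = 0 then x else y)"

text \<open>The product is the value of one Lie series in two free variables, because substitution commutes
  with \<open>exp\<close> and \<open>log\<close>.\<close>

lemma bch_universal:
  assumes "coeff x [] = 0" "coeff y [] = 0"
  shows "bch x y = substitute 2 (pair x y) (bch (var 0) (var 1))"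
proof -
  interpret substitution 2 "pair x y" using assms by unfold_locales (auto simp: pair_def)
  show ?thesis by (simp add: substitute_bch) (simp add: pair_def)
qed

lemma universal_bch_lie_series: "bch (var 0) (var 1) \<in> free_complete_lie_set 2"
  by (intro campbell_baker_hausdorff lie_series_var) auto

lemma coeff_log_letter: "coeff (ncs_log f) [i] = coeff (f - 1) [i]"
  by (simp add: ncs_log_def)

lemma coeff_exp_letter: "coeff (ncs_exp f) [i] = coeff f [i]"
  by (simp add: ncs_exp_def)

lemma coeff_universal_bch:
  "coeff (bch (var 0) (var 1 :: 'k::field_char_0 ncs)) [0] = 1"
  "coeff (bch (var 0) (var 1 :: 'k ncs)) [1] = 1"
  by (simp_all only: bch_def coeff_log_letter coeff_simps coeff_mult) (simp_all add: coeff_exp_letter)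

context closed_lie_ideal
begin

lemma bch_closed: "x \<in> free_complete_lie_set n \<Longrightarrow> y \<in> free_complete_lie_set n \<Longrightarrow> bch x y \<in> free_complete_lie_set n"
  by (rule campbell_baker_hausdorff)

text \<open>Both products are values of the same universal Lie series at congruent arguments.\<close>

lemma bch_cong:
  assumes "x - x' \<in> I" "y - y' \<in> I" "x \<in> free_complete_lie_set n" "x' \<in> free_complete_lie_set n"
    "y \<in> free_complete_lie_set n" "y' \<in> free_complete_lie_set n"
  shows "bch x y - bch x' y' \<in> I"
proof -
  have sub: "substitution 2 (pair x y)" "substitution 2 (pair x' y')"
    using assms(3-) by (auto intro!: substitution.intro coeff_lie_series_Nil simp: pair_def)
  have "substitute 2 (pair x y) (bch (var 0) (var 1)) - substitute 2 (pair x' y') (bch (var 0) (var 1)) \<in> I"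
  proof (rule cont_lie_hom_cong[of 2 "substitute 2 (pair x y)" "substitute 2 (pair x' y')"])
    show "cont_lie_hom 2 n (substitute 2 (pair x y))" "cont_lie_hom 2 n (substitute 2 (pair x' y'))"
      using assms(3-) by (auto intro!: cont_lie_hom_substitute simp: pair_def)
    show "substitute 2 (pair x y) (var i) - substitute 2 (pair x' y') (var i) \<in> I" if "i < 2" for i
      using assms(1,2) that substitution.substitute_var[OF sub(1)] substitution.substitute_var[OF sub(2)]
      by (auto simp: pair_def)
  qed (rule universal_bch_lie_series)
  then show ?thesis
    using assms(3-) by (metis bch_universal coeff_lie_series_Nil)
qed

text \<open>Modulo \<open>[x, y]\<close> every Lie polynomial in \<open>x\<close> and \<open>y\<close> reduces to its linear part, and the linear part of
  the universal series \<open>bch (var 0) (var 1)\<close> is \<open>var 0 + var 1\<close>.\<close>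

lemma bch_cong_add:
  assumes xy: "ncs_bracket x y \<in> I"
    and x: "x \<in> free_complete_lie_set n" and y: "y \<in> free_complete_lie_set n"
  shows "bch x y - (x + y) \<in> I"
proof -
  let ?S = "substitute 2 (pair x y)"
  define lin where "lin f = scale (coeff f [0]) x + scale (coeff f [1]) y" for f
  interpret substitution 2 "pair x y"
    using x y by unfold_locales (auto simp: pair_def intro: coeff_lie_series_Nil)
  interpret S: cont_lie_hom 2 n ?S
    using x y by (intro cont_lie_hom_substitute) (auto simp: pair_def)
  have lin: "lin f \<in> free_complete_lie_set n" for f
    unfolding lin_def by (intro lie_series_closed x y)
  have poly: "?S p - lin p \<in> I" if "p \<in> free_lie 2" for p
    using that
  proof (induction p rule: free_lie.induct)
    case (var i)
    then have "i = 0 \<or> i = 1" by auto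
    then show ?case by (auto simp: lin_def scale_simps scale_algebra zero_mem, simp_all add: pair_def zero_mem)
  next
    case zero
    show ?case by (simp add: lin_def scale_algebra zero_mem)
  next
    case (add p q)
    have "?S (p + q) - lin (p + q) = (?S p - lin p) + (?S q - lin q)"
      by (simp add: substitute_linear lin_def scale_algebra algebra_simps)
    then show ?case using add.IH add_mem by simp
  next
    case (scale p c)
    have "?S (scale c p) - lin (scale c p) = scale c (?S p - lin p)"
      by (simp add: substitute_linear lin_def scale_algebra scale_simps)
    then show ?case using scale.IH scale_mem by simp
  next
    case (bracket p q)
    have "lin (ncs_bracket p q) = 0"
      using bracket.hyps by (simp add: lin_def ncs_bracket_def coeff_mult scale_algebra)
    moreover have "ncs_bracket (lin p) (lin q) =
        scale (coeff p [0] * coeff q [1] - coeff p [1] * coeff q [0]) (ncs_bracket x y)"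
      by (rule ncs_eqI) (simp add: lin_def ncs_bracket_def scale_algebra algebra_simps)
    then have "ncs_bracket (lin p) (lin q) \<in> I" using xy scale_mem by simp
    moreover have "ncs_bracket (?S p) (?S q) - ncs_bracket (lin p) (lin q) \<in> I"
      using bracket by (intro cong_bracket lin S.mem free_lie_lie_series)
    ultimately show ?case using add_mem by (fastforce simp: substitute_bracket)
  qed
  let ?H = "bch (var 0) (var 1) :: 'k ncs"
  have "?S ?H - lin ?H \<in> I"
  proof (rule limit)
    show "?S ?H - lin ?H \<in> free_complete_lie_set n"
      by (intro lie_series_closed lin S.mem universal_bch_lie_series)
    fix d
    obtain p where p: "p \<in> free_lie 2" "agree (d + 2) ?H p"
      using agree_lie_series[OF universal_bch_lie_series] .
    have "lin ?H = lin p" using p(2) by (simp add: lin_def agree_def)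
    moreover have "agree d (?S ?H) (?S p)" using agree_substitute agree_mono[OF p(2)] by simp
    ultimately have "agree d (?S ?H - lin ?H) (?S p - lin p)" by (simp add: agree_diff)
    then show "\<exists>z\<in>I. agree d (?S ?H - lin ?H) z" using poly[OF p(1)] by blast
  qed
  moreover have "lin ?H = x + y" by (simp only: lin_def coeff_universal_bch scale_simps)
  moreover have "?S ?H = bch x y"
    using x y by (intro bch_universal[symmetric]) (auto intro: coeff_lie_series_Nil)
  ultimately show ?thesis by simp
qed

lemma bch_minus_cong:
  assumes "bch x (- y) \<in> I" and x: "x \<in> free_complete_lie_set n" and y: "y \<in> free_complete_lie_set n"
  shows "x - y \<in> I"
proof -
  have "bch (bch x (- y)) y - bch 0 y \<in> I"
    using assms by (intro bch_cong) (auto simp: zero_mem intro: bch_closed lie_series_closed)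
  then show ?thesis using x y by (simp add: bch_assoc bch_0)
qed

lemma bch_minus_cong_iff:
  assumes x: "x \<in> free_complete_lie_set n" and y: "y \<in> free_complete_lie_set n"
  shows "bch x (- y) \<in> I \<longleftrightarrow> x - y \<in> I"
proof
  assume "x - y \<in> I"
  then have "bch x (- y) - bch y (- y) \<in> I"
    using assms by (intro bch_cong) (auto simp: zero_mem intro: lie_series_closed)
  then show "bch x (- y) \<in> I" using y by (simp add: bch_0)
qed (simp add: bch_minus_cong assms)

text \<open>The left-hand side is the logarithm of \<open>e\<^sup>x e\<^sup>y e\<^sup>-\<^sup>x e\<^sup>-\<^sup>y\<close>. Since \<open>e\<^sup>x e\<^sup>y e\<^sup>-\<^sup>x\<close> is the
  exponential of \<open>Ad_exp x y\<close>, that logarithm lies in \<open>I\<close> iff \<open>Ad_exp x y - y = dexp x [x, y]\<close> does. For the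
  converse direction, \<open>dexp x\<close> is inverted modulo \<open>I\<close> by successive approximation.\<close>

lemma commutator_in_ideal_iff:
  assumes x: "x \<in> free_complete_lie_set n" and y: "y \<in> free_complete_lie_set n"
  shows "bch (bch (bch x y) (- x)) (- y) \<in> I \<longleftrightarrow> ncs_bracket x y \<in> I"
proof -
  let ?b = "ncs_bracket x y"
  have x0: "coeff x [] = 0" and y0: "coeff y [] = 0" using x y by auto
  have ord: "agree k (scale c (ad x k z)) 0" for k c z by (rule agree_scale_ad[OF x0])
  have Ad: "Ad_exp x y = y + isum (\<lambda>k. scale (1 / fact (Suc k)) (ad x (Suc k) y))"
    unfolding Ad_exp_def by (subst isum_first[OF ord]) (simp add: scale_simps)
  have adb: "ad x (Suc k) y = ad x k ?b" for k by (simp add: funpow_swap1)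
  have Ad_b: "Ad_exp x y - y = dexp x ?b"
    unfolding Ad adb dexp_def by simp
  have "coeff (Ad_exp x y) [] = 0" using x y by (intro coeff_lie_series_Nil lie_series_Ad_exp)
  have conj: "bch (bch x y) (- x) = Ad_exp x y"
  proof (rule ncs_exp_inj)
    have e: "ncs_exp (Ad_exp x y) = isum (\<lambda>k. scale (1 / fact k) ((ncs_exp x * y * ncs_exp (- x)) ^ k))"
      unfolding exp_conj[OF x0] by (rule ncs_exp_isum)
    have "(\<lambda>k. (ncs_exp x * y * ncs_exp (- x)) ^ k) = (\<lambda>k. ncs_exp x * y ^ k * ncs_exp (- x))"
    proof
      fix k
      show "(ncs_exp x * y * ncs_exp (- x)) ^ k = ncs_exp x * y ^ k * ncs_exp (- x)"
      proof (induction k)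
        case (Suc k)
        have "(ncs_exp x * y * ncs_exp (- x)) ^ Suc k
            = ncs_exp x * y * (ncs_exp (- x) * ncs_exp x) * y ^ k * ncs_exp (- x)"
          using Suc by (simp add: mult.assoc)
        then show ?case by (simp only: ncs_exp_minus[OF x0] mult_1_right power_Suc mult.assoc)
      qed (simp add: ncs_exp_minus x0)
    qed
    then have s: "(\<lambda>k. scale (1 / fact k) ((ncs_exp x * y * ncs_exp (- x)) ^ k))
        = (\<lambda>k. ncs_exp x * (scale (1 / fact k) (y ^ k) * ncs_exp (- x)))"
      by (simp add: fun_eq_iff scale_algebra mult.assoc)
    note e
    also note s
    also have "isum \<dots> = ncs_exp x * (ncs_exp y * ncs_exp (- x))"
    proof -
      have "agree k (scale (1 / fact k) (y ^ k) * ncs_exp (- x)) 0" for k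
        using agree_mult_zero[OF agree_fps_eval_term[OF y0], of 0 "ncs_exp (- x)" k "1 / fact k"] by simp
      then show ?thesis
        unfolding ncs_exp_isum[of y] by (simp add: isum_mult_left isum_mult_right agree_fps_eval_term y0)
    qed
    finally show "ncs_exp (bch (bch x y) (- x)) = ncs_exp (Ad_exp x y)"
      by (simp add: exp_bch mult.assoc)
  qed (simp_all add: \<open>coeff (Ad_exp x y) [] = 0\<close>)
  have "bch (bch (bch x y) (- x)) (- y) \<in> I \<longleftrightarrow> dexp x ?b \<in> I"
    unfolding conj by (subst bch_minus_cong_iff) (simp_all add: x y lie_series_Ad_exp Ad_b)
  also have "\<dots> \<longleftrightarrow> ?b \<in> I"
  proof
    have adI: "ad x k z \<in> I" if "z \<in> I" for z k
      using that x by (induction k) (auto intro: bracket_right)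
    show "dexp x ?b \<in> I" if "?b \<in> I"
      unfolding dexp_def by (rule isum_mem) (auto intro: ord scale_mem adI that simp del: fact_Suc)
    show "?b \<in> I" if dexp: "dexp x ?b \<in> I"
    proof (rule limit)
      show b: "?b \<in> free_complete_lie_set n" by (intro lie_series_closed x y)
      let ?r = "\<lambda>z. isum (\<lambda>k. scale (1 / fact (Suc (Suc k))) (ad x (Suc k) z))"
      have ord': "agree k (scale c (ad x (Suc k) z)) 0" for k c z
        using agree_mono[OF agree_scale_ad[OF x0, of "Suc k" c z]] by simp
      have eq: "?b = dexp x ?b - ?r ?b"
        unfolding dexp_def
        by (subst isum_first[OF ord]) (simp add: scale_simps del: fact_Suc funpow.simps)
      fix d
      \<comment> \<open>an approximation \<open>z\<close> of \<open>b = [x, y]\<close> in \<open>I\<close> is improved to \<open>dexp x b - r z\<close>, as every term of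
        \<open>r\<close> contains a bracket with \<open>x\<close>\<close>
      show "\<exists>z\<in>I. agree d ?b z"
      proof (induction d)
        case 0
        show ?case using zero_mem by auto
      next
        case (Suc d)
        then obtain z where z: "z \<in> I" "agree d ?b z" by blast
        have "agree (Suc d) (ad x (Suc k) ?b) (ad x (Suc k) z)" for k
        proof -
          have "agree d (ad x k ?b) (ad x k z)"
            using z(2) by (induction k) (auto intro: agree_bracket)
          moreover have "coeff (ad x k ?b) [] = 0" "coeff (ad x k z) [] = 0"
            using subset[OF z(1)] by (cases k; simp)+
          ultimately show ?thesis using x0 by (auto intro: agree_bracket_Suc)
        qed
        then have "agree (Suc d) (?r ?b) (?r z)"
          by (intro agree_isum_cong agree_scale)
        then have "agree (Suc d) ?b (dexp x ?b - ?r z)"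
          by (subst eq) (rule agree_diff, simp_all)
        moreover have "?r z \<in> I"
          by (rule isum_mem) (use adI[OF z(1)] in \<open>auto intro: ord' scale_mem simp del: fact_Suc funpow.simps\<close>)
        ultimately show ?case using diff_mem[OF dexp] by blast
      qed
    qed
  qed
  finally show ?thesis .
qed

end

section \<open>The group of Lie series and words in the free group\<close>

lemma exp_group_simps [simp]:
  "carrier (exp_group n) = free_complete_lie_set n" "x \<otimes>\<^bsub>exp_group n\<^esub> y = bch x y" "\<one>\<^bsub>exp_group n\<^esub> = 0"
  by (simp_all add: exp_group_def)

lemma group_exp_group: "group (exp_group n)"
proof (rule groupI)
  fix x :: "'a ncs" assume "x \<in> carrier (exp_group n)"
  then show "\<exists>y\<in>carrier (exp_group n). y \<otimes>\<^bsub>exp_group n\<^esub> x = \<one>\<^bsub>exp_group n\<^esub>"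
    by (intro bexI[of _ "- x"]) (auto simp: bch_0 lie_series_closed)
qed (auto simp: campbell_baker_hausdorff bch_assoc bch_0)

lemma inv_exp_group: "x \<in> free_complete_lie_set n \<Longrightarrow> inv\<^bsub>exp_group n\<^esub> x = - x"
  by (intro group.inv_equality group_exp_group) (auto simp: bch_0 lie_series_closed)

lemma free_group_simps [simp]:
  "\<one>\<^bsub>free_group n\<^esub> = []" "x \<otimes>\<^bsub>free_group n\<^esub> y = foldr push x y"
  by (simp_all add: free_group_def)

lemma letter_in_free_group: "fst a < n \<Longrightarrow> [a] \<in> carrier (free_group n)"
  by (simp add: free_group_def reduced_def)

text \<open>Together with \<open>free_lift_hom\<close> this is the universal property of the free group: a reduced word is the
  product of its letters.\<close>

lemma hom_eq_free_lift:
  assumes H: "group H" and h: "h \<in> hom (free_group n) H" and w: "w \<in> carrier (free_group n)"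
  shows "h w = free_lift H (\<lambda>i. h [(i, True)]) w"
  using w
proof (induction w)
  case Nil
  then show ?case
    using hom_one[OF h group_free_group H] by (simp add: free_lift_def)
next
  case (Cons a w)
  obtain i s where a: "a = (i, s)" by (cases a)
  have i: "i < n" and red: "reduced (a # w)" and w: "w \<in> carrier (free_group n)"
    using Cons.prems by (auto simp: free_group_def a reduced_def successively_Cons)
  have "push a w = a # w"
    using red by (cases w) (auto simp: reduced_def)
  then have "h (a # w) = h [a] \<otimes>\<^bsub>H\<^esub> h w"
    using hom_mult[OF h letter_in_free_group[of a n] w] i a by simp
  moreover have "h [(i, False)] = inv\<^bsub>H\<^esub> h [(i, True)]"
  proof -
    have "[(i, False)] = inv\<^bsub>free_group n\<^esub> [(i, True)]"
      by (rule group.inv_equality[OF group_free_group, symmetric])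
        (auto simp: cancels_def letter_in_free_group i)
    then show ?thesis
      using group_hom.hom_inv[of "free_group n" H h "[(i, True)]"] H h i
      by (simp add: group_hom_def group_hom_axioms_def group_free_group letter_in_free_group)
  qed
  ultimately show ?case
    using Cons.IH[OF w] a by (simp add: free_lift_def)
qed

lemma free_lift_cong:
  assumes "w \<in> carrier (free_group n)" "\<And>i. i < n \<Longrightarrow> g i = g' i"
  shows "free_lift H g w = free_lift H g' w"
proof -
  have "fst ` set w \<subseteq> {..<n}" using assms(1) by (simp add: free_group_def)
  then show ?thesis using assms(2) by (induction w) (auto simp: free_lift_def)
qed

lemma hom_free_group_unique:
  assumes "group H" "h \<in> hom (free_group n) H" "h' \<in> hom (free_group n) H"
    and "\<And>i. i < n \<Longrightarrow> h [(i, True)] = h' [(i, True)]" and w: "w \<in> carrier (free_group n)"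
  shows "h w = h' w"
proof -
  have "h w = free_lift H (\<lambda>i. h [(i, True)]) w" by (rule hom_eq_free_lift) fact+
  also have "\<dots> = free_lift H (\<lambda>i. h' [(i, True)]) w" by (rule free_lift_cong) fact+
  also have "\<dots> = h' w" by (rule hom_eq_free_lift[symmetric]) fact+
  finally show ?thesis .
qed

lemma sigma_hom: "sigma n \<in> hom (free_group n) (exp_group n)"
  unfolding sigma_def
  by (rule group.free_lift_hom[OF group_exp_group]) (simp add: lie_series_var)

lemma sigma_letter: "i < n \<Longrightarrow> sigma n [(i, True)] = var i"
  unfolding sigma_def
  by (rule group.free_lift_hom[OF group_exp_group]) (simp_all add: lie_series_var)

lemma sigma_group_hom: "group_hom (free_group n) (exp_group n) (sigma n)"
  by (simp add: group_hom_def group_hom_axioms_def group_free_group group_exp_group sigma_hom)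

lemma sigma_mem: "w \<in> carrier (free_group n) \<Longrightarrow> sigma n w \<in> free_complete_lie_set n"
  using hom_in_carrier[OF sigma_hom] by simp

lemma sigma_mult:
  "u \<in> carrier (free_group n) \<Longrightarrow> v \<in> carrier (free_group n) \<Longrightarrow>
    sigma n (u \<otimes>\<^bsub>free_group n\<^esub> v) = bch (sigma n u) (sigma n v)"
  using hom_mult[OF sigma_hom, of u n v] by simp

lemma sigma_inv: "u \<in> carrier (free_group n) \<Longrightarrow> sigma n (inv\<^bsub>free_group n\<^esub> u) = - sigma n u"
  using group_hom.hom_inv[OF sigma_group_hom, of u n] by (simp add: inv_exp_group sigma_mem)

lemma sigma_one [simp]: "sigma n [] = 0"
  using hom_one[OF sigma_hom group_free_group group_exp_group] by simp

context closed_lie_ideal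
begin

text \<open>\<open>I\<close> is a normal subgroup of \<open>exp(E\<^sub>n)\<close> because \<open>bch\<close> respects congruence modulo \<open>I\<close>, and preimages
  of normal subgroups are normal.\<close>

lemma normal_sigma_preimage:
  "{w \<in> carrier (free_group n). sigma n w \<in> I} \<lhd> free_group n" (is "?K \<lhd> _")
proof -
  interpret F: group "free_group n" by (rule group_free_group)
  have m: "bch x y \<in> I" if "x \<in> I" "y \<in> I" for x y
    using bch_cong[of x 0 y 0] that by (simp add: subset bch_0)
  have c: "bch (bch x y) (- x) \<in> I" if "x \<in> free_complete_lie_set n" "y \<in> I" for x y
  proof -
    have "bch x y - bch x 0 \<in> I"
      using that by (intro bch_cong) (auto simp: zero_mem subset)
    then have "bch (bch x y) (- x) - bch x (- x) \<in> I"
      using that by (intro bch_cong) (auto simp: zero_mem subset bch_0 bch_closed lie_series_closed)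
    then show ?thesis using that by (simp add: bch_0)
  qed
  show ?thesis
  proof (rule F.normal_invI)
    show "subgroup ?K (free_group n)"
    proof (rule F.subgroupI)
      show "?K \<noteq> {}" using F.one_closed zero_mem by force
      show "u \<otimes>\<^bsub>free_group n\<^esub> v \<in> ?K" if "u \<in> ?K" "v \<in> ?K" for u v
        using that m F.m_closed by (auto simp: sigma_mult simp del: free_group_simps)
    qed (auto simp: sigma_inv minus_mem)
    show "x \<otimes>\<^bsub>free_group n\<^esub> h \<otimes>\<^bsub>free_group n\<^esub> inv\<^bsub>free_group n\<^esub> x \<in> ?K"
      if "x \<in> carrier (free_group n)" "h \<in> ?K" for x h
      using that c by (auto simp: sigma_mult sigma_inv sigma_mem simp del: free_group_simps)
  qed
qed

text \<open>The quotient \<open>u v\<^sup>-\<^sup>1\<close> is a consequence of the relators, so it lies in every normal subgroup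
  that contains them, in particular in the one of \<open>normal_sigma_preimage\<close>.\<close>

lemma sigma_cong:
  assumes G: "group G" and pres: "finite_presentation G n R \<pi>" and R: "sigma n ` R \<subseteq> I"
    and u: "u \<in> carrier (free_group n)" and v: "v \<in> carrier (free_group n)" and uv: "\<pi> u = \<pi> v"
  shows "sigma n u - sigma n v \<in> I"
proof -
  interpret F: group "free_group n" by (rule group_free_group)
  interpret G: group G by fact
  have \<pi>: "group_hom (free_group n) G \<pi>"
    using pres by (simp add: finite_presentation_def epi_def group_hom_def group_hom_axioms_def
        F.is_group G.is_group)
  let ?w = "u \<otimes>\<^bsub>free_group n\<^esub> inv\<^bsub>free_group n\<^esub> v"
  have "\<pi> ?w = \<one>\<^bsub>G\<^esub>"
    using u v uv group_hom.hom_closed[OF \<pi> v]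
    by (simp add: group_hom.hom_mult[OF \<pi>] group_hom.hom_inv[OF \<pi>] del: free_group_simps)
  moreover have "?w \<in> carrier (free_group n)"
    by (intro F.m_closed F.inv_closed u v)
  ultimately have "?w \<in> kernel (free_group n) G \<pi>"
    by (simp only: kernel_def mem_Collect_eq simp_thms)
  also have "\<dots> = normal_closure (free_group n) R"
    using pres by (simp only: finite_presentation_def)
  also have "\<dots> \<subseteq> {w \<in> carrier (free_group n). sigma n w \<in> I}"
    unfolding normal_closure_def using normal_sigma_preimage R pres
    by (intro Inter_lower) (auto simp: finite_presentation_def)
  finally have "bch (sigma n u) (- sigma n v) \<in> I"
    using u v by (simp add: sigma_mult sigma_inv del: free_group_simps)
  then show ?thesis using u v by (intro bch_minus_cong sigma_mem)
qed

end

section \<open>Closed ideals generated by a set\<close>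

lemma closed_lie_ideal_UNIV: "closed_lie_ideal n (free_complete_lie_set n)"
  by unfold_locales (auto simp: lie_ideal_def filt_closed_def free_complete_lie_def intro: lie_series_closed)

lemma closed_ideal_eq:
  "closed_ideal (free_complete_lie n) S = \<Inter>{I. closed_lie_ideal n I \<and> S \<subseteq> I}"
  by (simp add: closed_ideal_def closed_lie_ideal_def)

lemma closed_ideal_least: "closed_lie_ideal n I \<Longrightarrow> S \<subseteq> I \<Longrightarrow> closed_ideal (free_complete_lie n) S \<subseteq> I"
  unfolding closed_ideal_eq by blast

lemma closed_ideal_upper: "S \<subseteq> closed_ideal (free_complete_lie n) S"
  unfolding closed_ideal_eq by blast

lemma closed_lie_ideal_closed_ideal:
  assumes "S \<subseteq> free_complete_lie_set n"
  shows "closed_lie_ideal n (closed_ideal (free_complete_lie n) S)" (is "closed_lie_ideal n ?C")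
proof
  have sub: "?C \<subseteq> free_complete_lie_set n"
    using closed_ideal_least[OF closed_lie_ideal_UNIV assms] .
  have mem: "x \<in> ?C \<longleftrightarrow> (\<forall>I. closed_lie_ideal n I \<and> S \<subseteq> I \<longrightarrow> x \<in> I)" for x
    unfolding closed_ideal_eq by blast
  show "lie_ideal (free_complete_lie n) ?C"
    unfolding lie_ideal_def using sub
    by (auto simp: free_complete_lie_def mem[unfolded free_complete_lie_def]
        intro: closed_lie_ideal.zero_mem closed_lie_ideal.add_mem closed_lie_ideal.scale_mem
          closed_lie_ideal.bracket_right)
  show "filt_closed (free_complete_lie n) ?C"
    unfolding filt_closed_def
  proof (intro ballI impI)
    fix x assume x: "x \<in> lcarrier (free_complete_lie n)"
      and ap: "\<forall>d. \<exists>y\<in>?C. \<exists>z\<in>lfilt (free_complete_lie n) d. x = ladd (free_complete_lie n) y z"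
    show "x \<in> ?C"
      unfolding mem
    proof (intro allI impI)
      fix I assume I: "closed_lie_ideal n I \<and> S \<subseteq> I"
      then have "?C \<subseteq> I" using closed_ideal_least by blast
      then have "\<exists>y\<in>I. \<exists>z\<in>lfilt (free_complete_lie n) d. x = ladd (free_complete_lie n) y z" for d
        using ap by (meson subsetD)
      moreover have "filt_closed (free_complete_lie n) I"
        using I closed_lie_ideal.closed by blast
      ultimately show "x \<in> I" using x unfolding filt_closed_def by blast
    qed
  qed
qed

lemma closed_lie_ideal_preimage:
  assumes \<theta>: "cont_lie_hom n m \<theta>" and J: "closed_lie_ideal m J"
  shows "closed_lie_ideal n {f \<in> free_complete_lie_set n. \<theta> f \<in> J}"
proof
  interpret \<theta>: cont_lie_hom n m \<theta> by fact
  interpret J: closed_lie_ideal m J by fact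
  let ?K = "{f \<in> free_complete_lie_set n. \<theta> f \<in> J}"
  show "lie_ideal (free_complete_lie n) ?K"
    by (auto simp: lie_ideal_def free_complete_lie_def \<theta>.zero \<theta>.add \<theta>.scale \<theta>.bracket \<theta>.mem
        intro: lie_series_closed J.zero_mem J.add_mem J.scale_mem J.bracket_right)
  show "filt_closed (free_complete_lie n) ?K"
    unfolding filt_closed_def
  proof (intro ballI impI)
    fix x assume "x \<in> lcarrier (free_complete_lie n)"
      and ap: "\<forall>d. \<exists>y\<in>?K. \<exists>z\<in>lfilt (free_complete_lie n) d. x = ladd (free_complete_lie n) y z"
    then have x: "x \<in> free_complete_lie_set n" by (simp add: free_complete_lie_def)
    have "\<exists>y\<in>J. agree d (\<theta> x) y" for d
    proof -
      obtain y z where y: "y \<in> ?K" "z \<in> lfilt (free_complete_lie n) d" "x = y + z"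
        using ap[rule_format, of d] by (auto simp: free_complete_lie_def)
      then have "agree d x y" by (simp add: agree_def free_complete_lie_def)
      then have "agree d (\<theta> x) (\<theta> y)" using x y(1) by (intro \<theta>.agree) auto
      then show ?thesis using y(1) by blast
    qed
    then show "x \<in> ?K" using x \<theta>.mem J.limit by blast
  qed
qed

section \<open>Quotients\<close>

context closed_lie_ideal
begin

abbreviation coset :: "'k ncs \<Rightarrow> 'k ncs set" where
  "coset \<equiv> lie_coset (free_complete_lie n) I"

abbreviation quotient :: "('k, 'k ncs set) filtered_lie" where
  "quotient \<equiv> lie_quotient (free_complete_lie n) I"

lemma mem_coset: "y \<in> coset x \<longleftrightarrow> y - x \<in> I"
  by (auto simp: lie_coset_def free_complete_lie_def image_iff algebra_simps)
    (metis add.commute diff_add_cancel)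

lemma self_mem_coset: "x \<in> coset x"
  by (simp add: mem_coset zero_mem)

lemma coset_eq_iff: "coset x = coset y \<longleftrightarrow> x - y \<in> I"
  using mem_coset self_mem_coset cong_sym cong_trans by blast

lemma coset_subset: "x \<in> free_complete_lie_set n \<Longrightarrow> coset x \<subseteq> free_complete_lie_set n"
proof
  fix y assume "x \<in> free_complete_lie_set n" "y \<in> coset x"
  then show "y \<in> free_complete_lie_set n"
    using lie_series_closed(3)[of "y - x" n x] subset[of "y - x"] by (simp add: mem_coset)
qed

text \<open>The operations of the quotient are defined as unions over all representatives; a union over a
  coset collapses as soon as the operation respects congruence.\<close>

lemma UN_coset:
  assumes "\<And>a. a \<in> free_complete_lie_set n \<Longrightarrow> a - x \<in> I \<Longrightarrow> F a = F x" "x \<in> free_complete_lie_set n"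
  shows "(\<Union>a\<in>coset x. F a) = F x"
  using assms coset_subset[of x] by (intro UN_constant_eq[OF self_mem_coset]) (auto simp: mem_coset)

lemma lcarrier_quotient: "lcarrier quotient = coset ` free_complete_lie_set n"
  by (simp add: lie_quotient_def free_complete_lie_def)

lemma lfilt_quotient:
  "lfilt quotient d = coset ` {f \<in> free_complete_lie_set n. agree d f 0}"
  by (simp add: lie_quotient_def free_complete_lie_def agree_def)

lemma quotient_scale:
  assumes x: "x \<in> free_complete_lie_set n"
  shows "lscale quotient c (coset x) = coset (scale c x)"
proof -
  have "lscale quotient c (coset x) = (\<Union>a\<in>coset x. coset (scale c a))"
    by (simp add: lie_quotient_def) (simp add: free_complete_lie_def)
  also have "\<dots> = coset (scale c x)"
    by (rule UN_coset[OF _ x]) (simp add: coset_eq_iff scale_mem flip: scale_algebra)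
  finally show ?thesis .
qed

lemma quotient_ops:
  assumes x: "x \<in> free_complete_lie_set n" and y: "y \<in> free_complete_lie_set n"
  shows "ladd quotient (coset x) (coset y) = coset (x + y)"
    and "lbracket quotient (coset x) (coset y) = coset (ncs_bracket x y)"
proof -
  have "ladd quotient (coset x) (coset y) = (\<Union>a\<in>coset x. \<Union>b\<in>coset y. coset (a + b))"
    by (simp add: lie_quotient_def) (simp add: free_complete_lie_def)
  also have "\<dots> = (\<Union>a\<in>coset x. coset (a + y))"
    by (intro SUP_cong refl UN_coset y) (simp add: coset_eq_iff)
  also have "\<dots> = coset (x + y)"
    by (rule UN_coset[OF _ x]) (simp add: coset_eq_iff)
  finally show "ladd quotient (coset x) (coset y) = coset (x + y)" .
  have "lbracket quotient (coset x) (coset y) = (\<Union>a\<in>coset x. \<Union>b\<in>coset y. coset (ncs_bracket a b))"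
    by (simp add: lie_quotient_def) (simp add: free_complete_lie_def)
  also have "\<dots> = (\<Union>a\<in>coset x. coset (ncs_bracket a y))"
    using coset_subset[OF x] y
    by (intro SUP_cong refl UN_coset y) (auto simp: coset_eq_iff zero_mem intro!: cong_bracket)
  also have "\<dots> = coset (ncs_bracket x y)"
    by (rule UN_coset[OF _ x]) (simp add: coset_eq_iff cong_bracket zero_mem x y)
  finally show "lbracket quotient (coset x) (coset y) = coset (ncs_bracket x y)" .
qed

end

text \<open>Continuity of the two maps gives that the induced bijection preserves the filtrations: each of them
  maps series of order at least \<open>d\<close> to such series.\<close>

lemma filtered_lie_iso_quotients:
  assumes I: "closed_lie_ideal n I" and J: "closed_lie_ideal m J"
    and \<theta>: "cont_lie_hom n m \<theta>" and \<eta>: "cont_lie_hom m n \<eta>"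
    and \<theta>I: "\<And>f. f \<in> I \<Longrightarrow> \<theta> f \<in> J" and \<eta>J: "\<And>f. f \<in> J \<Longrightarrow> \<eta> f \<in> I"
    and \<eta>\<theta>: "\<And>f. f \<in> free_complete_lie_set n \<Longrightarrow> \<eta> (\<theta> f) - f \<in> I"
    and \<theta>\<eta>: "\<And>f. f \<in> free_complete_lie_set m \<Longrightarrow> \<theta> (\<eta> f) - f \<in> J"
  shows "\<exists>\<phi>. filtered_lie_iso (lie_quotient (free_complete_lie n) I)
    (lie_quotient (free_complete_lie m) J) \<phi>"
proof -
  interpret I: closed_lie_ideal n I by fact
  interpret J: closed_lie_ideal m J by fact
  interpret \<theta>: cont_lie_hom n m \<theta> by fact
  interpret \<eta>: cont_lie_hom m n \<eta> by fact
  \<comment> \<open>a choice-free way to say \<open>x + I \<mapsto> \<theta> x + J\<close>\<close>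
  define \<phi> where "\<phi> A = (\<Union>a\<in>A. J.coset (\<theta> a))" for A
  have \<phi>: "\<phi> (I.coset x) = J.coset (\<theta> x)" if "x \<in> free_complete_lie_set n" for x
    unfolding \<phi>_def
    by (rule I.UN_coset[OF _ that]) (auto simp: J.coset_eq_iff that simp flip: \<theta>.diff intro: \<theta>I)
  have inj: "inj_on \<phi> (lcarrier I.quotient)"
  proof (rule inj_onI)
    fix A B assume "A \<in> lcarrier I.quotient" "B \<in> lcarrier I.quotient" and eq: "\<phi> A = \<phi> B"
    then obtain x y where xy: "x \<in> free_complete_lie_set n" "y \<in> free_complete_lie_set n"
      and AB: "A = I.coset x" "B = I.coset y"
      by (auto simp: I.lcarrier_quotient)
    have "\<theta> x - \<theta> y \<in> J" using eq by (simp add: AB \<phi> xy J.coset_eq_iff)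
    then have "\<eta> (\<theta> x) - \<eta> (\<theta> y) \<in> I" using \<eta>J xy by (simp add: \<theta>.mem flip: \<eta>.diff)
    then have "x - y \<in> I"
      using \<eta>\<theta>[OF xy(1)] \<eta>\<theta>[OF xy(2)] I.cong_sym I.cong_trans by blast
    then show "A = B" by (simp add: AB I.coset_eq_iff)
  qed
  have surj: "J.coset y = \<phi> (I.coset (\<eta> y))" if "y \<in> free_complete_lie_set m" for y
    using \<theta>\<eta>[OF that] that by (simp add: \<phi> \<eta>.mem J.coset_eq_iff J.cong_sym)
  have "\<phi> ` lcarrier I.quotient = lcarrier J.quotient"
  proof
    show "\<phi> ` lcarrier I.quotient \<subseteq> lcarrier J.quotient"
      by (auto simp: I.lcarrier_quotient J.lcarrier_quotient \<phi> \<theta>.mem)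
    show "lcarrier J.quotient \<subseteq> \<phi> ` lcarrier I.quotient"
      using surj \<eta>.mem by (auto simp: I.lcarrier_quotient J.lcarrier_quotient)
  qed
  moreover have "\<phi> ` lfilt I.quotient d = lfilt J.quotient d" for d
  proof
    show "\<phi> ` lfilt I.quotient d \<subseteq> lfilt J.quotient d"
      using \<theta>.agree[of _ 0 d] by (auto simp: I.lfilt_quotient J.lfilt_quotient \<phi> \<theta>.mem \<theta>.zero)
    show "lfilt J.quotient d \<subseteq> \<phi> ` lfilt I.quotient d"
    proof
      fix A assume "A \<in> lfilt J.quotient d"
      then obtain y where y: "y \<in> free_complete_lie_set m" "agree d y 0" "A = J.coset y"
        by (auto simp: J.lfilt_quotient)
      then have "\<eta> y \<in> {f \<in> free_complete_lie_set n. agree d f 0}"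
        using \<eta>.agree[of y 0 d] by (simp add: \<eta>.mem \<eta>.zero)
      then show "A \<in> \<phi> ` lfilt I.quotient d"
        unfolding I.lfilt_quotient y(3) surj[OF y(1)] by blast
    qed
  qed
  ultimately have "filtered_lie_iso I.quotient J.quotient \<phi>"
    using inj unfolding filtered_lie_iso_def bij_betw_def
    by (auto simp: I.lcarrier_quotient I.quotient_ops J.quotient_ops I.quotient_scale J.quotient_scale
        \<phi> \<theta>.mem \<theta>.add \<theta>.scale \<theta>.bracket
        lie_series_closed)
  then show ?thesis by blast
qed

section \<open>Independence of the presentation\<close>

lemma malcev_ideal:
  assumes "finite_presentation G n R \<pi>"
  shows "closed_lie_ideal n (closed_ideal (free_complete_lie n) (sigma n ` R))"
  using assms by (intro closed_lie_ideal_closed_ideal) (auto simp: finite_presentation_def intro: sigma_mem)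

text \<open>Generators of the first presentation are written as words \<open>u i\<close> in those of the second, and \<open>\<theta>\<close>
  substitutes the logarithm of \<open>u i\<close> for the \<open>i\<close>-th variable. Since substitution commutes with
  \<open>bch\<close>, it translates all words compatibly with the maps to \<open>G\<close>.\<close>

lemma lift_presentation:
  assumes G: "group G" and pres: "finite_presentation G n R \<pi>" and pres': "finite_presentation G m Q \<rho>"
  obtains \<theta> :: "'k::field_char_0 ncs \<Rightarrow> 'k ncs" where "cont_lie_hom n m \<theta>"
    "\<And>w. w \<in> carrier (free_group n) \<Longrightarrow>
      \<exists>v\<in>carrier (free_group m). \<rho> v = \<pi> w \<and> \<theta> (sigma n w) = sigma m v"
proof -
  have \<pi>: "\<pi> \<in> hom (free_group n) G" and \<rho>: "\<rho> \<in> hom (free_group m) G"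
    and surj: "\<rho> ` carrier (free_group m) = carrier G"
    using pres pres' by (auto simp: finite_presentation_def epi_def)
  have "\<forall>i. \<exists>u. i < n \<longrightarrow> u \<in> carrier (free_group m) \<and> \<rho> u = \<pi> [(i, True)]"
  proof
    fix i
    have "i < n \<Longrightarrow> \<pi> [(i, True)] \<in> \<rho> ` carrier (free_group m)"
      using hom_in_carrier[OF \<pi>] letter_in_free_group[of "(i, True)" n] surj by auto
    then show "\<exists>u. i < n \<longrightarrow> u \<in> carrier (free_group m) \<and> \<rho> u = \<pi> [(i, True)]" by force
  qed
  then obtain u where u: "\<And>i. i < n \<Longrightarrow> u i \<in> carrier (free_group m)"
      "\<And>i. i < n \<Longrightarrow> \<rho> (u i) = \<pi> [(i, True)]"
    by metis
  let ?\<theta> = "substitute n (\<lambda>i. sigma m (u i)) :: 'k ncs \<Rightarrow> 'k ncs"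
  let ?f = "free_lift (free_group m) u"
  have f: "?f \<in> hom (free_group n) (free_group m)" "\<And>i. i < n \<Longrightarrow> ?f [(i, True)] = u i"
    using group.free_lift_hom[OF group_free_group, of n u m] u(1) by auto
  have hom: "cont_lie_hom n m ?\<theta>"
    by (rule cont_lie_hom_substitute) (simp add: sigma_mem u)
  interpret \<theta>: cont_lie_hom n m ?\<theta> by fact
  interpret substitution n "\<lambda>i. sigma m (u i) :: 'k ncs"
    by unfold_locales (rule coeff_lie_series_Nil, rule sigma_mem, rule u)
  show ?thesis
  proof (rule that[OF hom])
    fix w assume w: "w \<in> carrier (free_group n)"
    have "\<rho> (?f w) = \<pi> w"
      using hom_free_group_unique[OF G hom_compose[OF f(1) \<rho>] \<pi> _ w] f(2) u(2) by simp
    moreover have "?\<theta> (sigma n w) = sigma m (?f w)"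
    proof -
      have "?\<theta> \<circ> sigma n \<in> hom (free_group n) (exp_group m)"
        by (rule homI) (simp_all add: sigma_mem \<theta>.mem sigma_mult substitute_bch coeff_lie_series_Nil[OF sigma_mem]
            del: free_group_simps)
      from hom_free_group_unique[OF group_exp_group this hom_compose[OF f(1) sigma_hom] _ w]
      show ?thesis using f(2) by (simp add: sigma_letter)
    qed
    moreover have "?f w \<in> carrier (free_group m)" by (rule hom_in_carrier[OF f(1) w])
    ultimately show "\<exists>v\<in>carrier (free_group m). \<rho> v = \<pi> w \<and> ?\<theta> (sigma n w) = sigma m v" by blast
  qed
qed

theorem malcev_lie_presentation_independent:
  assumes G: "group G" and pres: "finite_presentation G n R \<pi>" and pres': "finite_presentation G m Q \<rho>"
  shows "\<exists>\<phi>. filtered_lie_iso (malcev_lie n R :: ('k::field_char_0, 'k ncs set) filtered_lie) (malcev_lie m Q) \<phi>"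
proof -
  obtain \<theta> :: "'k ncs \<Rightarrow> 'k ncs" where \<theta>: "cont_lie_hom n m \<theta>"
    "\<And>w. w \<in> carrier (free_group n) \<Longrightarrow>
      \<exists>v\<in>carrier (free_group m). \<rho> v = \<pi> w \<and> \<theta> (sigma n w) = sigma m v"
    using lift_presentation[OF G pres pres'] by blast
  obtain \<eta> :: "'k ncs \<Rightarrow> 'k ncs" where \<eta>: "cont_lie_hom m n \<eta>"
    "\<And>w. w \<in> carrier (free_group m) \<Longrightarrow>
      \<exists>v\<in>carrier (free_group n). \<pi> v = \<rho> w \<and> \<eta> (sigma m w) = sigma n v"
    using lift_presentation[OF G pres' pres] by blast
  \<comment> \<open>stated with fresh variables, since they are used once in each direction\<close>
  have ideal: "\<theta> f \<in> closed_ideal (free_complete_lie m) (sigma m ` Q)"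
    if pres: "finite_presentation G n R \<pi>" and pres': "finite_presentation G m Q \<rho>"
      and \<theta>: "cont_lie_hom n m \<theta>" "\<And>w. w \<in> carrier (free_group n) \<Longrightarrow>
        \<exists>v\<in>carrier (free_group m). \<rho> v = \<pi> w \<and> \<theta> (sigma n w) = sigma m v"
      and f: "f \<in> closed_ideal (free_complete_lie n) (sigma n ` R)"
    for n m R Q \<pi> \<rho> f and \<theta> :: "'k ncs \<Rightarrow> 'k ncs"
  proof -
    let ?J = "closed_ideal (free_complete_lie m) (sigma m ` Q) :: 'k ncs set"
    interpret J: closed_lie_ideal m ?J by (rule malcev_ideal[OF pres'])
    have "sigma n ` R \<subseteq> {f \<in> free_complete_lie_set n. \<theta> f \<in> ?J}"
    proof clarify
      fix r assume r: "r \<in> R"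
      then have rF: "r \<in> carrier (free_group n)" using pres by (auto simp: finite_presentation_def)
      have "r \<in> normal_closure (free_group n) R" using r by (auto simp: normal_closure_def)
      then have "\<pi> r = \<one>\<^bsub>G\<^esub>" using pres by (auto simp: finite_presentation_def kernel_def)
      also have "\<dots> = \<rho> []"
        using pres' hom_one[OF _ group_free_group G, of \<rho> m] by (simp add: finite_presentation_def epi_def)
      finally obtain v where v: "v \<in> carrier (free_group m)" "\<rho> v = \<rho> []" "\<theta> (sigma n r) = sigma m v"
        using \<theta>(2)[OF rF] by auto
      have "[] \<in> carrier (free_group m)" by (simp add: free_group_def reduced_def)
      then have "sigma m v - sigma m [] \<in> ?J"
        using v by (intro J.sigma_cong[OF G pres' closed_ideal_upper])
      then show "sigma n r \<in> free_complete_lie_set n \<and> \<theta> (sigma n r) \<in> ?J"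
        using rF v(3) by (simp add: sigma_mem)
    qed
    from closed_ideal_least[OF closed_lie_ideal_preimage[OF \<theta>(1) J.closed_lie_ideal_axioms] this] f
    show ?thesis by blast
  qed
  have inverse: "\<eta> (\<theta> f) - f \<in> closed_ideal (free_complete_lie n) (sigma n ` R)"
    if pres: "finite_presentation G n R \<pi>"
      and \<theta>: "cont_lie_hom n m \<theta>" "\<And>w. w \<in> carrier (free_group n) \<Longrightarrow>
        \<exists>v\<in>carrier (free_group m). \<rho> v = \<pi> w \<and> \<theta> (sigma n w) = sigma m v"
      and \<eta>: "cont_lie_hom m n \<eta>" "\<And>w. w \<in> carrier (free_group m) \<Longrightarrow>
        \<exists>v\<in>carrier (free_group n). \<pi> v = \<rho> w \<and> \<eta> (sigma m w) = sigma n v"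
      and f: "f \<in> free_complete_lie_set n"
    for n m R \<pi> \<rho> f and \<theta> \<eta> :: "'k ncs \<Rightarrow> 'k ncs"
  proof -
    let ?I = "closed_ideal (free_complete_lie n) (sigma n ` R) :: 'k ncs set"
    interpret I: closed_lie_ideal n ?I by (rule malcev_ideal[OF pres])
    have "\<eta> (\<theta> (var i)) - var i \<in> ?I" if i: "i < n" for i
    proof -
      have l: "[(i, True)] \<in> carrier (free_group n)" using i by (simp add: letter_in_free_group)
      obtain v where v: "v \<in> carrier (free_group n)" "\<pi> v = \<pi> [(i, True)]"
          "\<eta> (\<theta> (sigma n [(i, True)])) = sigma n v"
        using \<theta>(2)[OF l] \<eta>(2) by metis
      then have "sigma n v - sigma n [(i, True)] \<in> ?I"
        by (intro I.sigma_cong[OF G pres closed_ideal_upper] l)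
      then show ?thesis using v(3) i by (simp add: sigma_letter)
    qed
    then show ?thesis
      using I.cont_lie_hom_cong[OF cont_lie_hom_comp[OF \<theta>(1) \<eta>(1)] cont_lie_hom_id _ f] by simp
  qed
  show ?thesis
    unfolding malcev_lie_def
    by (rule filtered_lie_iso_quotients[OF malcev_ideal[OF pres] malcev_ideal[OF pres'] \<theta>(1) \<eta>(1)])
      (rule ideal[OF pres pres' \<theta>] ideal[OF pres' pres \<eta>]
        inverse[OF pres \<theta> \<eta>] inverse[OF pres' \<eta> \<theta>]; assumption)+
qed

section \<open>Commutator relators\<close>

lemma pos_word_mem: "set xs \<subseteq> {..<n} \<Longrightarrow> pos_word xs \<in> carrier (free_group n)"
proof -
  have "successively (\<lambda>a b. \<not> cancels a b) (pos_word xs)" for xs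
    by (induction xs rule: induct_list012) (auto simp: pos_word_def cancels_def)
  then show "set xs \<subseteq> {..<n} \<Longrightarrow> pos_word xs \<in> carrier (free_group n)"
    by (auto simp: free_group_def reduced_def pos_word_def)
qed

lemma sigma_pos_word: "sigma n (pos_word xs) = foldr bch (map var xs) 0"
  by (induction xs) (auto simp: sigma_def free_lift_def pos_word_def)

lemma sigma_comm_relator:
  assumes "set xs \<subseteq> {..<n}" "set ys \<subseteq> {..<n}"
  shows "sigma n (comm_relator n xs ys) =
    (let x = sigma n (pos_word xs); y = sigma n (pos_word ys) in bch (bch (bch x y) (- x)) (- y))"
proof -
  interpret F: group "free_group n" by (rule group_free_group)
  show ?thesis
    using assms[THEN pos_word_mem]
    by (simp add: comm_relator_def commutator_def sigma_mult sigma_inv Let_def del: free_group_simps)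
qed

definition var_sum :: "nat list \<Rightarrow> 'k::field_char_0 ncs" where
  "var_sum xs = (\<Sum>i\<leftarrow>xs. var i)"

lemma lie_series_var_sum: "set xs \<subseteq> {..<n} \<Longrightarrow> var_sum xs \<in> free_complete_lie_set n"
  by (induction xs) (auto simp: var_sum_def intro: lie_series_closed lie_series_var)

lemma homogeneous_bracket:
  assumes "homogeneous 1 f" "homogeneous 1 g"
  shows "homogeneous 2 (ncs_bracket f g)"
proof -
  have m: "homogeneous 2 (f * g)" if "homogeneous 1 f" "homogeneous 1 g" for f g :: "'a ncs"
    unfolding homogeneous_def
  proof (intro allI impI)
    fix w assume "coeff (f * g) w \<noteq> 0"
    then obtain i where "coeff f (take i w) * coeff g (drop i w) \<noteq> 0"
      unfolding coeff_mult by (meson sum.not_neutral_contains_not_neutral)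
    then have "coeff f (take i w) \<noteq> 0" "coeff g (drop i w) \<noteq> 0" by auto
    then have "length (take i w) = 1" "length (drop i w) = 1"
      using that unfolding homogeneous_def by blast+
    then show "length w = 2" by (metis append_take_drop_id length_append one_add_one)
  qed
  show ?thesis
    using m[OF assms] m[OF assms(2,1)] by (auto simp: homogeneous_def ncs_bracket_def) metis
qed

lemma homogeneous_var_sum: "homogeneous 1 (var_sum xs)"
proof -
  have "coeff (var_sum xs) w = 0" if "length w \<noteq> 1" for w
    using that by (induction xs) (auto simp: var_sum_def)
  then show ?thesis unfolding homogeneous_def by blast
qed

context closed_lie_ideal
begin

text \<open>By induction the product of the remaining letters is congruent to their sum, so the first letter
  commutes with it modulo \<open>I\<close>, and \<open>bch_cong_add\<close> applies.\<close>

lemma sigma_pos_word_cong: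
  assumes "set xs \<subseteq> {..<n}"
    and "\<And>i j. i \<in> set xs \<Longrightarrow> j \<in> set xs \<Longrightarrow> ncs_bracket (var i) (var j) \<in> I"
  shows "sigma n (pos_word xs) - var_sum xs \<in> I"
  using assms
proof (induction xs)
  case Nil
  then show ?case by (simp add: sigma_pos_word var_sum_def zero_mem)
next
  case (Cons i xs)
  let ?x = "sigma n (pos_word xs)"
  have x: "?x \<in> free_complete_lie_set n" "var_sum xs \<in> free_complete_lie_set n"
    "var i \<in> free_complete_lie_set n" and IH: "?x - var_sum xs \<in> I"
    using Cons by (auto intro!: sigma_mem pos_word_mem lie_series_var_sum lie_series_var)
  have "ncs_bracket (var i) (var_sum ys) \<in> I" if "set ys \<subseteq> set xs" for ys
    using that Cons.prems(2) by (induction ys) (auto simp: var_sum_def scale_simps zero_mem intro: add_mem)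
  then have "ncs_bracket (var i) (var_sum xs) \<in> I" by simp
  moreover have "ncs_bracket (var i) ?x - ncs_bracket (var i) (var_sum xs) \<in> I"
    using x IH by (intro cong_bracket) (simp_all add: zero_mem)
  ultimately have "ncs_bracket (var i) ?x \<in> I" using add_mem by fastforce
  from add_mem[OF bch_cong_add[OF this x(3,1)] IH] show ?case
    by (simp add: sigma_pos_word var_sum_def algebra_simps)
qed

lemma comm_relator_iff:
  assumes "set xs \<subseteq> {..<n}" "set ys \<subseteq> {..<n}"
    and xs: "\<And>i j. i \<in> set xs \<Longrightarrow> j \<in> set xs \<Longrightarrow> ncs_bracket (var i) (var j) \<in> I"
    and ys: "\<And>i j. i \<in> set ys \<Longrightarrow> j \<in> set ys \<Longrightarrow> ncs_bracket (var i) (var j) \<in> I"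
  shows "sigma n (comm_relator n xs ys) \<in> I \<longleftrightarrow> ncs_bracket (var_sum xs) (var_sum ys) \<in> I"
proof -
  let ?x = "sigma n (pos_word xs) :: 'k ncs" and ?y = "sigma n (pos_word ys) :: 'k ncs"
  have E: "?x \<in> free_complete_lie_set n" "?y \<in> free_complete_lie_set n"
    "var_sum xs \<in> free_complete_lie_set n" "var_sum ys \<in> free_complete_lie_set n"
    using assms(1,2) by (auto intro!: sigma_mem pos_word_mem lie_series_var_sum)
  have "sigma n (comm_relator n xs ys) \<in> I \<longleftrightarrow> ncs_bracket ?x ?y \<in> I"
    using assms(1,2) E by (simp add: sigma_comm_relator Let_def commutator_in_ideal_iff)
  moreover have "ncs_bracket ?x ?y - ncs_bracket (var_sum xs) (var_sum ys) \<in> I"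
    using assms by (intro cong_bracket sigma_pos_word_cong E)
  then have "ncs_bracket ?x ?y \<in> I \<longleftrightarrow> ncs_bracket (var_sum xs) (var_sum ys) \<in> I"
    using add_mem diff_mem by (metis diff_add_cancel diff_diff_eq2 add_diff_cancel_left')
  ultimately show ?thesis by simp
qed

text \<open>For single letters the commutation hypotheses of \<open>comm_relator_iff\<close> hold trivially. This is what
  makes them available for longer words.\<close>

lemma comm_relator_letters_iff:
  assumes "i < n" "j < n"
  shows "sigma n (comm_relator n [i] [j]) \<in> I \<longleftrightarrow> ncs_bracket (var i) (var j) \<in> I"
proof -
  have "ncs_bracket (var i) (var i) = (0 :: 'k ncs)" for i by (simp add: ncs_bracket_def)
  then show ?thesis
    using comm_relator_iff[of "[i]" "[j]"] assms by (simp add: var_sum_def zero_mem)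
qed

end

text \<open>By \<open>comm_relator_iff\<close>, membership of a relator in a closed ideal that contains the brackets of
  commuting letters is equivalent to membership of a homogeneous element of degree \<open>2\<close>. Applied to \<open>I\<close> it
  shows that the quadratic elements lie in \<open>I\<close>, and then applied to the ideal \<open>J\<close> they generate it shows
  that \<open>J\<close> contains the relators.\<close>

theorem malcev_ideal_quadratic:
  fixes n :: nat and T :: "(nat list \<times> nat list) set"
  defines "R \<equiv> {comm_relator n xs ys | xs ys. (xs, ys) \<in> T}"
  defines "I \<equiv> closed_ideal (free_complete_lie n) (sigma n ` R) :: 'k::field_char_0 ncs set"
  assumes letters: "\<And>xs ys. (xs, ys) \<in> T \<Longrightarrow> set xs \<subseteq> {..<n} \<and> set ys \<subseteq> {..<n}"
    and comm_xs: "\<And>xs ys i j. (xs, ys) \<in> T \<Longrightarrow> i \<in> set xs \<Longrightarrow> j \<in> set xs \<Longrightarrow> comm_relator n [i] [j] \<in> R"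
    and comm_ys: "\<And>xs ys i j. (xs, ys) \<in> T \<Longrightarrow> i \<in> set ys \<Longrightarrow> j \<in> set ys \<Longrightarrow> comm_relator n [i] [j] \<in> R"
  shows "I = closed_ideal (free_complete_lie n) {f \<in> I. homogeneous 2 f}" (is "_ = ?J")
proof
  interpret F: group "free_group n" by (rule group_free_group)
  have "R \<subseteq> carrier (free_group n)"
    using letters pos_word_mem[of _ n] unfolding R_def comm_relator_def commutator_def
    by (auto simp del: free_group_simps intro!: F.m_closed F.inv_closed)
  then interpret I: closed_lie_ideal n I
    unfolding I_def by (intro closed_lie_ideal_closed_ideal) (auto intro: sigma_mem)
  interpret J: closed_lie_ideal n ?J
    by (rule closed_lie_ideal_closed_ideal) (use I.subset in blast)
  show "?J \<subseteq> I"
    by (rule closed_ideal_least[OF I.closed_lie_ideal_axioms]) blast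
  have RI: "sigma n r \<in> I" if "r \<in> R" for r
    using closed_ideal_upper[of "sigma n ` R"] that unfolding I_def by blast
  have quad: "f \<in> ?J" if "f \<in> I" "homogeneous 2 f" for f
    using closed_ideal_upper[of "{f \<in> I. homogeneous 2 f}" n] that by blast
  have letters_J: "ncs_bracket (var i) (var j) \<in> I \<and> ncs_bracket (var i) (var j) \<in> ?J"
    if "comm_relator n [i] [j] \<in> R" "i < n" "j < n" for i j
  proof -
    have "ncs_bracket (var i) (var j) \<in> I"
      using RI[OF that(1)] that(2,3) by (simp add: I.comm_relator_letters_iff)
    moreover have "homogeneous 2 (ncs_bracket (var i) (var j) :: 'k ncs)"
      using homogeneous_bracket[OF homogeneous_var_sum[of "[i]"] homogeneous_var_sum[of "[j]"]]
      by (simp add: var_sum_def)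
    ultimately show ?thesis using quad by blast
  qed
  have "sigma n ` R \<subseteq> ?J"
  proof clarify
    fix r assume "r \<in> R"
    then obtain xs ys where T: "(xs, ys) \<in> T" and r: "r = comm_relator n xs ys"
      unfolding R_def by blast
    note l = letters[OF T]
    have br: "ncs_bracket (var i) (var j) \<in> I \<and> ncs_bracket (var i) (var j) \<in> ?J"
      if "i \<in> set xs \<and> j \<in> set xs \<or> i \<in> set ys \<and> j \<in> set ys" for i j
      using that l comm_xs[OF T] comm_ys[OF T] by (intro letters_J) auto
    have "ncs_bracket (var_sum xs) (var_sum ys) \<in> I"
      using I.comm_relator_iff[of xs ys] RI[OF \<open>r \<in> R\<close>] l br r by blast
    then have "ncs_bracket (var_sum xs) (var_sum ys) \<in> ?J"
      by (intro quad homogeneous_bracket homogeneous_var_sum)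
    then show "sigma n r \<in> ?J"
      using J.comm_relator_iff[of xs ys] l br r by blast
  qed
  then show "I \<subseteq> ?J"
    by (subst I_def) (rule closed_ideal_least[OF J.closed_lie_ideal_axioms])
qed

theorem theorem2p1:
  fixes G :: "('g, 'b) monoid_scheme" and n :: nat
    and T :: "(nat list \<times> nat list) set"
    and R :: "letter list set" and \<pi> :: "letter list \<Rightarrow> 'g"
  assumes "group G"
    and "finite_presentation G n R \<pi>"
    and "R = {comm_relator n xs ys | xs ys. (xs, ys) \<in> T}"
    and "\<And>xs ys. (xs, ys) \<in> T \<Longrightarrow>
      xs \<noteq> [] \<and> ys \<noteq> [] \<and> set xs \<subseteq> {..<n} \<and> set ys \<subseteq> {..<n}"
    and "\<And>xs ys i j. (xs, ys) \<in> T \<Longrightarrow> i < length xs \<Longrightarrow> j < length xs \<Longrightarrow>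
      comm_relator n [xs ! i] [xs ! j] \<in> R"
    and "\<And>xs ys i j. (xs, ys) \<in> T \<Longrightarrow> i < length ys \<Longrightarrow> j < length ys \<Longrightarrow>
      comm_relator n [ys ! i] [ys ! j] \<in> R"
  shows "one_formal TYPE('k::field_char_0) G"
proof -
  let ?I = "closed_ideal (free_complete_lie n) (sigma n ` R) :: 'k ncs set"
  let ?S = "{f \<in> ?I. homogeneous 2 f}"
  have comm: "comm_relator n [i] [j] \<in> R"
    if "(xs, ys) \<in> T" "i \<in> set xs \<and> j \<in> set xs \<or> i \<in> set ys \<and> j \<in> set ys" for xs ys i j
    using that assms(5,6) unfolding in_set_conv_nth by blast
  have "?I = closed_ideal (free_complete_lie n) ?S"
    unfolding assms(3)
    by (rule malcev_ideal_quadratic) (use assms(4) comm in \<open>auto simp flip: assms(3)\<close>)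
  then have malcev: "malcev_lie n R = lie_quotient (free_complete_lie n) (closed_ideal (free_complete_lie n) ?S)"
    by (simp add: malcev_lie_def)
  have S: "?S \<subseteq> lcarrier (free_complete_lie n)"
    using closed_lie_ideal.subset[OF malcev_ideal[OF assms(2)]] by (auto simp: free_complete_lie_def)
  have "quadratic (malcev_lie m Q :: ('k, 'k ncs set) filtered_lie)"
    if pres: "finite_presentation G m Q \<rho>" for m Q \<rho>
  proof -
    obtain \<phi> where "filtered_lie_iso (malcev_lie m Q :: ('k, 'k ncs set) filtered_lie) (malcev_lie n R) \<phi>"
      using malcev_lie_presentation_independent[OF assms(1) pres assms(2)] by blast
    then show ?thesis
      unfolding quadratic_def malcev using S by blast
  qed
  then show ?thesis
    using assms(2) unfolding one_formal_def by blast
qed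

end
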